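(* For $n\ge1$ and integers $m,e,\ell$, let $\beta_{n,m,e,\ell}$ be the number of elements $x\in W(B_n)$ with $x^2=1$, of length $\ell$, whose expression as a product of disjoint signed cycles contains exactly $m$ transpositions and exactly $e$ negative $1$-cycles, and let $L_{n,m,e}(t)=\sum_{\ell=0}^{\infty}\beta_{n,m,e,\ell}t^{\ell}$. Let $n\ge 3$, $m\ge 0$ and $e\ge 0$. If $\ell<m+e$ then $\beta_{n,m,e,\ell}=0$. If $\ell\ge m+e$ then $$\beta_{n,m,e,\ell}=\beta_{n-1,m,e,\ell}+\beta_{n-1,m,e-1,\ell+1-2n}+\sum_{k=1}^{2n-2}\beta_{n-2,m-1,e,\ell+1-2k}.$$ Moreover $L_{n,0,0}(t)=1$ for all positive integers $n$, $L_{1,0,1}(t)=t$, $L_{2,1,0}(t)=t+t^3$, $L_{2,0,1}(t)=t+t^3$, $L_{2,0,2}(t)=t^4$, $L_{n,m,e}(t)=0$ whenever $n<2m+e$, and for all $n\ge 3$ and $m,e\ge 0$, $$L_{n,m,e}(t)=L_{n-1,m,e}(t)+t^{2n-1}L_{n-1,m,e-1}(t)+\frac{t(t^{4n-4}-1)}{t^2-1}L_{n-2,m-1,e}(t).$$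
   Context: $W(B_n)$ ($n\ge 1$) is the group of signed permutations of $\{1,\dots,n\}$: bijections $w$ of $\{\pm1,\dots,\pm n\}$ with $w(-i)=-w(i)$. It acts on $\mathbb{R}^n$ with orthonormal basis $e_1,\dots,e_n$ by $w\cdot e_i=e_{w(i)}$, where $e_{-i}=-e_i$. The positive roots are $e_j\pm e_i$ ($1\le i<j\le n$) and $e_i$ ($1\le i\le n$); the fundamental reflections are those in the simple roots $e_1$ and $e_{i+1}-e_i$ ($1\le i<n$). The length $\ell(w)$ is the least number of fundamental reflections in an expression for $w$; equivalently it is the number of positive roots sent to negative roots by $w$. An element with $w^2=1$ is a product of disjoint signed cycles each of which is a positive $1$-cycle ($i\mapsto i$), a negative $1$-cycle ($i\mapsto -i$), or a transposition, namely $i\leftrightarrow j$ or $i\mapsto -j,\ j\mapsto -i$ with $i\neq j$. The identity counts as an involution, so $\beta_{n,0,0,0}=1$. Counts with a negative index $m$, $e$ or $\ell$ are zero (and likewise $L_{n,m,e}(t)=0$ if $m<0$ or $e<0$). *)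

theory Defs
  imports Complex_Main
    "HOL-Combinatorics.Permutations"
    "HOL-Computational_Algebra.Formal_Power_Series"
begin

text \<open>
  A signed permutation is a function on all integers, equal to the identity outside
  \<open>{\<plusminus>1,\<dots>,\<plusminus>n}\<close>; the group operation is composition.
\<close>

definition signed_points :: "nat \<Rightarrow> int set" where
  "signed_points n = {i. 1 \<le> \<bar>i\<bar> \<and> \<bar>i\<bar> \<le> int n}"

definition WB :: "nat \<Rightarrow> (int \<Rightarrow> int) set" where
  "WB n = {w. w permutes signed_points n \<and> (\<forall>i \<in> signed_points n. w (- i) = - w i)}"

text \<open>
  Since \<open>n\<close> varies, vectors of \<open>\<real>\<^sup>n\<close> are functions on \<^typ>\<open>nat\<close> that vanish
  outside \<open>{1..n}\<close>. The vector \<open>basis_vec i\<close> is $e_i$, with $e_{-i} = -e_i$.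
\<close>

definition Rvecs :: "nat \<Rightarrow> (nat \<Rightarrow> real) set" where
  "Rvecs n = {v. \<forall>k. k \<notin> {1..n} \<longrightarrow> v k = 0}"

definition basis_vec :: "int \<Rightarrow> nat \<Rightarrow> real" where
  "basis_vec i = (\<lambda>k. if int k = \<bar>i\<bar> then of_int (sgn i) else 0)"

definition inner_prod :: "nat \<Rightarrow> (nat \<Rightarrow> real) \<Rightarrow> (nat \<Rightarrow> real) \<Rightarrow> real" where
  "inner_prod n u v = (\<Sum>i = 1..n. u i * v i)"

text \<open>The linear extension of $w \cdot e_i = e_{w(i)}$.\<close>

definition act :: "nat \<Rightarrow> (int \<Rightarrow> int) \<Rightarrow> (nat \<Rightarrow> real) \<Rightarrow> (nat \<Rightarrow> real)" where
  "act n w v = (\<lambda>k. \<Sum>i = 1..n. v i * basis_vec (w (int i)) k)"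

definition reflection :: "nat \<Rightarrow> (nat \<Rightarrow> real) \<Rightarrow> (nat \<Rightarrow> real) \<Rightarrow> (nat \<Rightarrow> real)" where
  "reflection n r v = (\<lambda>k. v k - 2 * inner_prod n v r / inner_prod n r r * r k)"

definition simple_roots :: "nat \<Rightarrow> (nat \<Rightarrow> real) set" where
  "simple_roots n =
     insert (basis_vec 1)
       {(\<lambda>k. basis_vec (int i + 1) k - basis_vec (int i) k) | i. 1 \<le> i \<and> i < n}"

definition fundamental_reflections :: "nat \<Rightarrow> (int \<Rightarrow> int) set" where
  "fundamental_reflections n =
     {w \<in> WB n. \<exists>r \<in> simple_roots n. \<forall>v \<in> Rvecs n. act n w v = reflection n r v}"

definition product :: "(int \<Rightarrow> int) list \<Rightarrow> int \<Rightarrow> int" where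
  "product ws = foldr (\<circ>) ws id"

definition len :: "nat \<Rightarrow> (int \<Rightarrow> int) \<Rightarrow> nat" where
  "len n w =
     (LEAST k. \<exists>ws. length ws = k \<and> set ws \<subseteq> fundamental_reflections n \<and> product ws = w)"

definition moved :: "(int \<Rightarrow> int) \<Rightarrow> int set" where
  "moved c = {i. c i \<noteq> i}"

text \<open>
  A signed cycle is a signed permutation whose moved points form, up to sign, a single
  orbit. The identity is included, because it is the value of every positive 1-cycle.
\<close>

definition signed_cycle :: "nat \<Rightarrow> (int \<Rightarrow> int) \<Rightarrow> bool" where
  "signed_cycle n c \<longleftrightarrow>
     c \<in> WB n \<and> (\<forall>i \<in> moved c. \<forall>j \<in> moved c. \<exists>k. \<bar>(c ^^ k) i\<bar> = \<bar>j\<bar>)"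

definition negative_1_cycle :: "nat \<Rightarrow> (int \<Rightarrow> int) \<Rightarrow> bool" where
  "negative_1_cycle n c \<longleftrightarrow>
     c \<in> WB n \<and> (\<exists>i \<in> {1..int n}. c i = - i \<and> moved c = {i, - i})"

definition transposition_cycle :: "nat \<Rightarrow> (int \<Rightarrow> int) \<Rightarrow> bool" where
  "transposition_cycle n c \<longleftrightarrow>
     c \<in> WB n \<and>
     (\<exists>i \<in> {1..int n}. \<exists>j \<in> {1..int n}. i \<noteq> j \<and> moved c = {i, j, - i, - j} \<and>
        (c i = j \<and> c j = i \<or> c i = - j \<and> c j = - i))"

text \<open>
  Expressions as products of disjoint signed cycles. Positive 1-cycles may be listed
  (as identity maps) or left out; every other factor is determined, up to order, by \<open>w\<close>.
\<close>

definition disjoint_cycle_expression :: "nat \<Rightarrow> (int \<Rightarrow> int) \<Rightarrow> (int \<Rightarrow> int) list \<Rightarrow> bool" where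
  "disjoint_cycle_expression n w cs \<longleftrightarrow>
     (\<forall>c \<in> set cs. signed_cycle n c) \<and>
     sorted_wrt (\<lambda>c d. moved c \<inter> moved d = {}) cs \<and>
     product cs = w"

text \<open>
  The indices \<open>m\<close>, \<open>e\<close>, \<open>l\<close> are integers, so that the count is zero when one of
  them is negative.
\<close>

definition \<beta> :: "nat \<Rightarrow> int \<Rightarrow> int \<Rightarrow> int \<Rightarrow> nat" where
  "\<beta> n m e l =
     card {x \<in> WB n. x \<circ> x = id \<and> int (len n x) = l \<and>
       (\<exists>cs. disjoint_cycle_expression n x cs \<and>
          int (length (filter (transposition_cycle n) cs)) = m \<and>
          int (length (filter (negative_1_cycle n) cs)) = e)}"

definition L :: "nat \<Rightarrow> int \<Rightarrow> int \<Rightarrow> rat fps" where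
  "L n m e = Abs_fps (\<lambda>l. of_nat (\<beta> n m e (int l)))"

end

theory Submission
  imports Defs
begin

text \<open>
  The length of a signed permutation is its number of inversions, i.e. of positive roots sent
  to negative ones. An involution \<open>x\<close> is classified by $a = x(n)$. If $a = n$, then
  \<open>x\<close> lives on $n-1$ points with the same inversions; if $a = -n$, removing the negative
  1-cycle removes the $2n-1$ inversions involving $n$. Otherwise, let $g$ be the number of
  signed points greater than $a$. Since $a$ and $n$ are exchanged, exactly $g$ points $i$
  form an inversion $(i, n)$ and exactly $g$ points $j$ form an inversion $(a, j)$, with
  $(a, n)$ common to both, so removing the transposition removes $2g-1$ inversions, whatever
  the rest of \<open>x\<close> is. As $a$ runs over its $2n-2$ values, $g$ runs over $1, \dots, 2n-2$.
\<close>

subsection \<open>Length and inversions\<close>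

text \<open>Once the transposition of \<open>n\<close> and \<open>a\<close> is removed, the
  remaining points have a gap at \<open>a\<close> and \<open>- a\<close>. The statistics are
  therefore defined over an arbitrary set \<open>S\<close> of integers, and an increasing odd
  relabelling closes the gap. The numbers of transpositions and negative 1-cycles are read off
  pointwise, as sizes of \<open>swaps\<close> and \<open>negs\<close>, and these agree with the
  counts in every disjoint cycle expression. An obstacle in the length part is that a root can have
  two representatives as a pair and only one of them is listed, so a reflection does not simply act
  on the listed pairs. The rational factor in the generating function is the finite sum t + t^3 +
  ... + t^(4n-5), with one term t^(2g-1) for each g.\<close>

text \<open>
  With $e_{-i} = -e_i$, the pair \<open>(i, j)\<close> stands for the positive root proportional to
  $e_j - e_i$; in particular \<open>(- j, j)\<close> stands for $e_j$. Positivity of $e_b - e_a$ is just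
  \<open>a < b\<close>, and \<open>(i, j)\<close> and \<open>(- j, - i)\<close> give the same root, whence \<open>0 \<le> i + j\<close>.
\<close>

definition root_pairs :: "int set \<Rightarrow> (int \<times> int) set" where
  "root_pairs S = {(i, j). i \<in> S \<and> j \<in> S \<and> i < j \<and> 0 \<le> i + j}"

definition inversions :: "int set \<Rightarrow> (int \<Rightarrow> int) \<Rightarrow> (int \<times> int) set" where
  "inversions S w = {(i, j) \<in> root_pairs S. w j < w i}"

definition neg_one :: "int \<Rightarrow> int" where
  "neg_one i = (if i = 1 then - 1 else if i = - 1 then 1 else i)"

definition adj_swap :: "int \<Rightarrow> int \<Rightarrow> int" where
  "adj_swap k i =
     (if i = k then k + 1 else if i = k + 1 then k
      else if i = - k then - k - 1 else if i = - k - 1 then - k else i)"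

lemma finite_signed_points [simp]: "finite (signed_points n)"
proof (rule finite_subset)
  show "signed_points n \<subseteq> {- int n..int n}"
    by (auto simp: signed_points_def)
qed simp

lemma finite_root_pairs [simp]: "finite S \<Longrightarrow> finite (root_pairs S)"
  by (rule finite_subset[of _ "S \<times> S"]) (auto simp: root_pairs_def)

lemma finite_inversions [simp]: "finite S \<Longrightarrow> finite (inversions S w)"
  by (rule finite_subset[of _ "root_pairs S"]) (auto simp: inversions_def)

text \<open>A simple reflection permutes the positive roots other than its own root
  \<open>p\<close>. So \<open>f\<close> matches the inversions of \<open>w\<close> and
  \<open>w'\<close> away from \<open>p\<close>, and only the status of \<open>p\<close> changes. The
  map \<open>f\<close> is abstract because it has to respect the choice of representatives.\<close>

lemma card_inversions_step:
  assumes "finite S" and p: "p \<in> root_pairs S"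
    and into: "\<And>q. q \<in> root_pairs S - {p} \<Longrightarrow> f q \<in> root_pairs S - {p}"
    and invol: "\<And>q. q \<in> root_pairs S - {p} \<Longrightarrow> f (f q) = q"
    and inv: "\<And>q. q \<in> root_pairs S - {p} \<Longrightarrow> f q \<in> inversions S w \<longleftrightarrow> q \<in> inversions S w'"
    and p_inv: "p \<in> inversions S w' \<longleftrightarrow> p \<notin> inversions S w"
  shows "int (card (inversions S w')) =
    (if p \<in> inversions S w then int (card (inversions S w)) - 1
     else int (card (inversions S w)) + 1)"
proof -
  have sub: "inversions S v \<subseteq> root_pairs S" for v
    by (auto simp: inversions_def)
  have "bij_betw f (inversions S w' - {p}) (inversions S w - {p})"
  proof (rule bij_betw_byWitness[where f' = f])
    show "\<forall>a\<in>inversions S w' - {p}. f (f a) = a" using invol sub by blast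
    show "\<forall>a\<in>inversions S w - {p}. f (f a) = a" using invol sub by blast
    show "f ` (inversions S w' - {p}) \<subseteq> inversions S w - {p}"
      using into inv sub by blast
    show "f ` (inversions S w - {p}) \<subseteq> inversions S w' - {p}"
    proof
      fix r assume "r \<in> f ` (inversions S w - {p})"
      then obtain q where q: "q \<in> inversions S w" "q \<noteq> p" "r = f q" by blast
      then have "q \<in> root_pairs S - {p}" using sub by blast
      then show "r \<in> inversions S w' - {p}" using into[of q] inv[of "f q"] invol[of q] q by simp
    qed
  qed
  then have eq: "card (inversions S w' - {p}) = card (inversions S w - {p})"
    by (rule bij_betw_same_card)
  have remove: "int (card A) = int (card (A - {p})) + (if p \<in> A then 1 else 0)" if "finite A" for A
    using card_Suc_Diff1[OF that, of p] by auto
  show ?thesis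
    using eq p_inv remove[OF finite_inversions[OF assms(1), of w]]
      remove[OF finite_inversions[OF assms(1), of w']]
    by (auto simp only: if_True if_False split: if_splits)
qed

section \<open>Signed permutations and the effect of a generator on the number of inversions\<close>

lemma WB_odd: "w \<in> WB n \<Longrightarrow> w (- i) = - w i"
  unfolding WB_def permutes_def by (cases "i \<in> signed_points n") (auto simp: signed_points_def)

lemma WB_in: "w \<in> WB n \<Longrightarrow> w i \<in> signed_points n \<longleftrightarrow> i \<in> signed_points n"
  unfolding WB_def by (auto simp: permutes_in_image)

lemma WB_inj: "w \<in> WB n \<Longrightarrow> w i = w j \<longleftrightarrow> i = j"
  unfolding WB_def using permutes_inj[of w] by (auto simp: inj_eq)

lemma WB_outside: "w \<in> WB n \<Longrightarrow> i \<notin> signed_points n \<Longrightarrow> w i = i"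
  unfolding WB_def by (auto simp: permutes_not_in)

lemma WB_zero [simp]: "w \<in> WB n \<Longrightarrow> w 0 = 0"
  using WB_odd[of w n 0] by simp

lemma WB_comp: "w \<in> WB n \<Longrightarrow> v \<in> WB n \<Longrightarrow> w \<circ> v \<in> WB n"
  using WB_odd[of w n] WB_odd[of v n] unfolding WB_def by (auto simp: permutes_compose)

lemma WB_eqI:
  assumes "w \<in> WB n" "v \<in> WB n" "\<And>i. 1 \<le> i \<Longrightarrow> i \<le> int n \<Longrightarrow> w i = v i"
  shows "w = v"
proof
  fix i
  consider "i \<notin> signed_points n" | "1 \<le> i" "i \<le> int n" | "1 \<le> - i" "- i \<le> int n"
    by (fastforce simp: signed_points_def)
  then show "w i = v i"
  proof cases
    case 3
    then show ?thesis using assms(3)[of "- i"] WB_odd[OF assms(1), of i] WB_odd[OF assms(2), of i] by simp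
  qed (use assms WB_outside[of w n i] WB_outside[of v n i] in auto)
qed

lemma involution_in_WB:
  assumes "\<And>i. i \<notin> signed_points n \<Longrightarrow> w i = i" "\<And>i. w (- i) = - w i" "\<And>i. w (w i) = i"
  shows "w \<in> WB n"
proof -
  have "w permutes signed_points n"
    unfolding permutes_def using assms(1,3) by metis
  then show ?thesis using assms(2) by (simp add: WB_def)
qed

lemma id_in_WB: "id \<in> WB n"
  by (rule involution_in_WB) auto

lemma neg_one_neg_one [simp]: "neg_one (neg_one i) = i"
  by (auto simp: neg_one_def)

lemma adj_swap_adj_swap [simp]: "1 \<le> k \<Longrightarrow> adj_swap k (adj_swap k i) = i"
  by (auto simp: adj_swap_def)

lemma neg_one_in_WB: "1 \<le> n \<Longrightarrow> neg_one \<in> WB n"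
  by (rule involution_in_WB) (auto simp: neg_one_def signed_points_def)

lemma adj_swap_in_WB: "1 \<le> k \<Longrightarrow> k < int n \<Longrightarrow> adj_swap k \<in> WB n"
  by (rule involution_in_WB) (auto simp: adj_swap_def signed_points_def)

lemma card_inversions_neg_one:
  assumes w: "w \<in> WB n" and n: "1 \<le> n"
  shows "int (card (inversions (signed_points n) (w \<circ> neg_one))) =
    int (card (inversions (signed_points n) w)) + (if w 1 < 0 then - 1 else 1)"
proof -
  let ?S = "signed_points n"
  have m1: "w (- 1) = - w 1" using WB_odd[OF w] by simp
  have nz: "w 1 \<noteq> 0" using WB_inj[OF w, of 1 0] w by simp
  have s_in: "neg_one i \<in> ?S \<longleftrightarrow> i \<in> ?S" for i
    using WB_in[OF neg_one_in_WB[OF n]] .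
  have p_iff: "(- 1, 1) \<in> inversions ?S v \<longleftrightarrow> v 1 < v (- 1)" for v
    using n by (auto simp: inversions_def root_pairs_def signed_points_def)
  have "int (card (inversions ?S (w \<circ> neg_one))) =
    (if (- 1, 1) \<in> inversions ?S w then int (card (inversions ?S w)) - 1
     else int (card (inversions ?S w)) + 1)"
  proof (rule card_inversions_step[where f = "map_prod neg_one neg_one"])
    show p: "(- 1, 1) \<in> root_pairs ?S" using n by (auto simp: root_pairs_def signed_points_def)
    show into: "map_prod neg_one neg_one q \<in> root_pairs ?S - {(- 1, 1)}"
      if "q \<in> root_pairs ?S - {(- 1, 1)}" for q
    proof (cases q)
      case (Pair i j)
      have ij: "i \<in> ?S" "j \<in> ?S" "i < j" "0 \<le> i + j" "\<not> (i = - 1 \<and> j = 1)"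
        using that Pair by (auto simp: root_pairs_def)
      \<comment> \<open>A pair with \<open>j = 1\<close> would have to be \<open>(- 1, 1)\<close>.
        So \<open>neg_one\<close> fixes \<open>j\<close>, and at most the sign of \<open>i\<close>
        changes, with |i| = 1 < j.\<close>
      then have "i \<noteq> 0" "2 \<le> j" by (auto simp: signed_points_def)
      then have "neg_one i < neg_one j \<and> 0 \<le> neg_one i + neg_one j \<and> neg_one j = j"
        using ij by (auto simp: neg_one_def)
      then show ?thesis using ij s_in[of i] s_in[of j] \<open>2 \<le> j\<close> Pair
        by (auto simp: root_pairs_def)
    qed
    show "map_prod neg_one neg_one (map_prod neg_one neg_one q) = q" for q
      by (cases q) simp
    show "map_prod neg_one neg_one q \<in> inversions ?S w \<longleftrightarrow> q \<in> inversions ?S (w \<circ> neg_one)"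
      if "q \<in> root_pairs ?S - {(- 1, 1)}" for q
      using that into[OF that] by (cases q) (auto simp: inversions_def)
    show "(- 1, 1) \<in> inversions ?S (w \<circ> neg_one) \<longleftrightarrow> (- 1, 1) \<notin> inversions ?S w"
      unfolding p_iff using m1 nz by (auto simp: neg_one_def)
  qed simp
  then show ?thesis using m1 nz by (auto simp: p_iff)
qed

lemma card_inversions_adj_swap:
  assumes w: "w \<in> WB n" and k: "1 \<le> k" "k < int n"
  shows "int (card (inversions (signed_points n) (w \<circ> adj_swap k))) =
    int (card (inversions (signed_points n) w)) + (if w (k + 1) < w k then - 1 else 1)"
proof -
  let ?S = "signed_points n" and ?s = "adj_swap k"
  \<comment> \<open>The reflection fixes the root $e_{k+1} + e_k$, but sends its representative
    \<open>(- k, k + 1)\<close> to the other one, \<open>(- k - 1, k)\<close>.\<close>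
  define f where "f q = (if q = (- k, k + 1) then q else map_prod ?s ?s q)" for q
  have ne: "w k \<noteq> w (k + 1)" using WB_inj[OF w] by simp
  have s_in: "?s i \<in> ?S \<longleftrightarrow> i \<in> ?S" for i
    using WB_in[OF adj_swap_in_WB[OF k]] .
  have p_iff: "(k, k + 1) \<in> inversions ?S v \<longleftrightarrow> v (k + 1) < v k" for v
    using k by (auto simp: inversions_def root_pairs_def signed_points_def)
  \<comment> \<open>The swap reverses the order only of \<open>(k, k + 1)\<close> and
    \<open>(- k - 1, - k)\<close>, and the latter has negative sum. The sum becomes negative only
    for \<open>(- k, k + 1)\<close>.\<close>
  have into': "?s i < ?s j \<and> 0 \<le> ?s i + ?s j \<and> (?s i, ?s j) \<notin> {(k, k + 1), (- k, k + 1)}"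
    if "(i, j) \<in> root_pairs ?S" "(i, j) \<noteq> (k, k + 1)" "(i, j) \<noteq> (- k, k + 1)" for i j
    using that k by (auto simp: adj_swap_def root_pairs_def)
  have "int (card (inversions ?S (w \<circ> ?s))) =
    (if (k, k + 1) \<in> inversions ?S w then int (card (inversions ?S w)) - 1
     else int (card (inversions ?S w)) + 1)"
  proof (rule card_inversions_step[where f = f])
    show "(k, k + 1) \<in> root_pairs ?S" using k by (auto simp: root_pairs_def signed_points_def)
    show into: "f q \<in> root_pairs ?S - {(k, k + 1)}"
      if "q \<in> root_pairs ?S - {(k, k + 1)}" for q
    proof (cases "q = (- k, k + 1)")
      case True
      then show ?thesis using that by (simp add: f_def)
    next
      case False
      obtain i j where q: "q = (i, j)" by (cases q)
      have "?s i \<in> ?S" "?s j \<in> ?S" using that q s_in by (auto simp: root_pairs_def)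
      then show ?thesis using into'[of i j] that q False
        by (auto simp: f_def root_pairs_def)
    qed
    show "f (f q) = q" if "q \<in> root_pairs ?S - {(k, k + 1)}" for q
    proof (cases "q = (- k, k + 1)")
      case True
      then show ?thesis by (simp add: f_def)
    next
      case False
      obtain i j where q: "q = (i, j)" by (cases q)
      then show ?thesis using into'[of i j] that False k by (auto simp: f_def)
    qed
    show "f q \<in> inversions ?S w \<longleftrightarrow> q \<in> inversions ?S (w \<circ> ?s)"
      if "q \<in> root_pairs ?S - {(k, k + 1)}" for q
    proof (cases "q = (- k, k + 1)")
      case True
      \<comment> \<open>On both sides the condition says that \<open>w k + w (k + 1)\<close> is
        negative.\<close>
      have "w (- k) = - w k" "w (- k - 1) = - w (k + 1)"
        using WB_odd[OF w, of k] WB_odd[OF w, of "k + 1"] by simp_all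
      then show ?thesis using that True k by (auto simp: f_def inversions_def adj_swap_def)
    next
      case False
      then show ?thesis using that into[OF that] by (cases q) (auto simp: f_def inversions_def)
    qed
    show "(k, k + 1) \<in> inversions ?S (w \<circ> ?s) \<longleftrightarrow> (k, k + 1) \<notin> inversions ?S w"
      unfolding p_iff using ne k by (auto simp: adj_swap_def)
  qed simp
  then show ?thesis using ne by (auto simp: p_iff)
qed

text \<open>The values increase strictly from at least 1 to at most \<open>n\<close>. Induction
  upwards from 1 bounds \<open>w j\<close> below by \<open>j\<close>, and induction downwards from
  \<open>n\<close> bounds it above.\<close>

lemma WB_eq_id_if_no_descent:
  assumes w: "w \<in> WB n" and pos: "0 < w 1"
    and mono: "\<And>k. 1 \<le> k \<Longrightarrow> k < int n \<Longrightarrow> w k < w (k + 1)"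
  shows "w = id"
proof (rule WB_eqI[OF w id_in_WB])
  fix i assume i: "1 \<le> i" "i \<le> int n"
  have "j \<le> int n \<longrightarrow> j \<le> w j" if "1 \<le> j" for j
    using that
  proof (induction j rule: int_ge_induct)
    case base
    then show ?case using pos by simp
  next
    case (step j)
    then show ?case using mono[of j] by auto
  qed
  moreover have "1 \<le> j \<longrightarrow> w j \<le> j" if "j \<le> int n" for j
    using that
  proof (induction j rule: int_le_induct)
    case base
    then show ?case using WB_in[OF w, of "int n"] by (auto simp: signed_points_def)
  next
    case (step j)
    then show ?case using mono[of "j - 1"] by auto
  qed
  ultimately show "w i = id i" using i by force
qed

section \<open>The fundamental reflections as explicit signed permutations\<close>

lemma basis_vec_inj:
  assumes "basis_vec i = basis_vec j" "i \<noteq> 0"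
  shows "i = j"
proof -
  have eq: "basis_vec j (nat \<bar>i\<bar>) = of_int (sgn i)"
    unfolding assms(1)[symmetric] by (simp add: basis_vec_def)
  have "\<bar>i\<bar> = \<bar>j\<bar>"
  proof (rule ccontr)
    assume "\<bar>i\<bar> \<noteq> \<bar>j\<bar>"
    then have "(of_int (sgn i) :: real) = of_int 0"
      unfolding eq[symmetric] by (simp add: basis_vec_def)
    then have "sgn i = 0" by (simp only: of_int_eq_iff)
    then show False using assms(2) by (simp add: sgn_0_0)
  qed
  moreover from this have "(of_int (sgn i) :: real) = of_int (sgn j)"
    unfolding eq[symmetric] by (simp add: basis_vec_def)
  then have "sgn i = sgn j" by (simp only: of_int_eq_iff)
  ultimately have "\<bar>i\<bar> = \<bar>j\<bar> \<and> sgn i = sgn j" by simp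
  then show ?thesis by (metis sgn_mult_abs)
qed

lemma basis_vec_in_Rvecs: "1 \<le> i \<Longrightarrow> i \<le> n \<Longrightarrow> basis_vec (int i) \<in> Rvecs n"
  by (auto simp: Rvecs_def basis_vec_def)

lemma act_basis_vec:
  assumes "1 \<le> i" "i \<le> n"
  shows "act n w (basis_vec (int i)) = basis_vec (w (int i))"
proof
  fix k
  have "act n w (basis_vec (int i)) k = (\<Sum>j = 1..n. if j = i then basis_vec (w (int i)) k else 0)"
    unfolding act_def using assms by (intro sum.cong) (auto simp: basis_vec_def)
  then show "act n w (basis_vec (int i)) k = basis_vec (w (int i)) k"
    using assms by simp
qed

text \<open>Coordinate \<open>k\<close> of the image comes from the index that \<open>w\<close>
  sends to \<open>k\<close> up to sign. For an involution this index is |w k|, so the inverse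
  permutation does not appear.\<close>

lemma act_involution:
  assumes w: "w \<in> WB n" and inv: "\<And>i. w (w i) = i" and v: "v \<in> Rvecs n"
  shows "act n w v k = of_int (sgn (w (int k))) * v (nat \<bar>w (int k)\<bar>)"
proof -
  have basis: "basis_vec (w (int i)) k =
      (if i = nat \<bar>w (int k)\<bar> then of_int (sgn (w (int k))) else 0)" if "i \<in> {1..n}" for i
  proof (cases "int k = \<bar>w (int i)\<bar>")
    case True
    then have "w (int k) = sgn (w (int i)) * int i"
      using inv[of "int i"] WB_odd[OF w, of "w (int i)"] WB_zero[OF w] that
      by (auto simp: abs_if sgn_if split: if_splits)
    moreover have "w (int i) \<noteq> 0"
      using WB_in[OF w, of "int i"] that by (auto simp: signed_points_def)
    ultimately show ?thesis using that True
      by (auto simp: basis_vec_def abs_mult sgn_mult sgn_if)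
  next
    case False
    have "i \<noteq> nat \<bar>w (int k)\<bar>"
    proof
      assume "i = nat \<bar>w (int k)\<bar>"
      then have "w (int i) = int k \<or> w (int i) = - int k"
        using inv[of "int k"] WB_odd[OF w, of "w (int k)"] by (auto simp: abs_if split: if_splits)
      then show False using False by auto
    qed
    then show ?thesis using False by (simp add: basis_vec_def)
  qed
  have "act n w v k =
      (\<Sum>i = 1..n. if i = nat \<bar>w (int k)\<bar> then v i * of_int (sgn (w (int k))) else 0)"
    unfolding act_def by (intro sum.cong) (auto simp: basis)
  \<comment> \<open>If the index lies outside \<open>{1..n}\<close>, the sum is 0, and so is
    \<open>v\<close> there.\<close>
  also have "\<dots> = of_int (sgn (w (int k))) * v (nat \<bar>w (int k)\<bar>)"
    using v by (auto simp: Rvecs_def)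
  finally show ?thesis .
qed

lemma reflection_basis_vec_1:
  assumes "1 \<le> n"
  shows "reflection n (basis_vec 1) v = (\<lambda>k. if k = 1 then - v 1 else v k)"
proof -
  have 1: "inner_prod n u (basis_vec 1) = u 1" for u
  proof -
    have "inner_prod n u (basis_vec 1) = (\<Sum>i = 1..n. if i = 1 then u 1 else 0)"
      unfolding inner_prod_def by (intro sum.cong) (auto simp: basis_vec_def)
    then show ?thesis using assms by simp
  qed
  show ?thesis unfolding reflection_def 1 by (auto simp: basis_vec_def)
qed

lemma reflection_basis_vec_diff:
  assumes "1 \<le> i" "i < n"
  shows "reflection n (\<lambda>k. basis_vec (int i + 1) k - basis_vec (int i) k) v =
    (\<lambda>k. if k = i then v (Suc i) else if k = Suc i then v i else v k)"
proof -
  let ?r = "\<lambda>k. basis_vec (int i + 1) k - basis_vec (int i) k :: real"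
  have r: "?r k = (if k = Suc i then 1 else if k = i then - 1 else 0)" for k
    using assms by (auto simp: basis_vec_def)
  \<comment> \<open>Applied to \<open>?r\<close> itself this also gives the squared norm 2 in the
    denominator of the reflection.\<close>
  have 1: "inner_prod n u ?r = u (Suc i) - u i" for u
  proof -
    have "inner_prod n u ?r =
        (\<Sum>j = 1..n. (if j = Suc i then u (Suc i) else 0) - (if j = i then u i else 0))"
      unfolding inner_prod_def r by (intro sum.cong) auto
    then show ?thesis using assms by (simp add: sum_subtractf)
  qed
  show ?thesis unfolding reflection_def 1 unfolding r using assms by (auto simp: field_simps)
qed

text \<open>From left to right, the images of the basis vectors determine a signed permutation. From
  right to left, the action has to be compared on every vector, and \<open>act_involution\<close>
  applies because the generators are involutions.\<close>

lemma fundamental_reflections_eq: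
  assumes n: "1 \<le> n"
  shows "fundamental_reflections n = insert neg_one {adj_swap k | k. 1 \<le> k \<and> k < int n}"
    (is "_ = ?R")
proof (intro equalityI subsetI)
  fix w assume "w \<in> fundamental_reflections n"
  then obtain r where w: "w \<in> WB n" and r: "r \<in> simple_roots n"
    and eq: "\<And>v. v \<in> Rvecs n \<Longrightarrow> act n w v = reflection n r v"
    by (auto simp: fundamental_reflections_def)
  have determined: "w = s" if s: "s \<in> WB n"
    and refl: "\<And>j. 1 \<le> j \<Longrightarrow> j \<le> n \<Longrightarrow> reflection n r (basis_vec (int j)) = basis_vec (s (int j))" for s
  proof (rule WB_eqI[OF w s])
    fix i assume i: "1 \<le> i" "i \<le> int n"
    define j where "j = nat i"
    have j: "1 \<le> j" "j \<le> n" "i = int j" using i by (auto simp: j_def)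
    have "basis_vec (w i) = basis_vec (s i)"
      using eq[OF basis_vec_in_Rvecs[OF j(1,2)]] act_basis_vec[OF j(1,2)] refl[OF j(1,2)] j(3) by simp
    moreover have "w i \<noteq> 0" using WB_in[OF w, of i] i by (auto simp: signed_points_def)
    ultimately show "w i = s i" by (rule basis_vec_inj)
  qed
  consider "r = basis_vec 1"
    | i where "1 \<le> i" "i < n" "r = (\<lambda>k. basis_vec (int i + 1) k - basis_vec (int i) k)"
    using r by (auto simp: simple_roots_def)
  then show "w \<in> ?R"
  proof cases
    case 1
    have "w = neg_one"
    proof (rule determined[OF neg_one_in_WB[OF n]])
      show "reflection n r (basis_vec (int j)) = basis_vec (neg_one (int j))" if "1 \<le> j" for j
        unfolding 1 reflection_basis_vec_1[OF n] using that
        by (auto simp: basis_vec_def neg_one_def)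
    qed
    then show ?thesis by simp
  next
    case 2
    have "w = adj_swap (int i)"
    proof (rule determined)
      show "adj_swap (int i) \<in> WB n" using 2 by (simp add: adj_swap_in_WB)
      show "reflection n r (basis_vec (int j)) = basis_vec (adj_swap (int i) (int j))"
        if "1 \<le> j" for j
        unfolding 2(3) reflection_basis_vec_diff[OF 2(1,2)] using that 2(1)
        by (auto simp: basis_vec_def adj_swap_def)
    qed
    then show ?thesis using 2 by auto
  qed
next
  fix w assume "w \<in> ?R"
  then consider "w = neg_one" | k where "w = adj_swap k" "1 \<le> k" "k < int n" by auto
  then show "w \<in> fundamental_reflections n"
  proof cases
    case 1
    have "act n neg_one v = reflection n (basis_vec 1) v" if "v \<in> Rvecs n" for v
    proof
      fix k
      \<comment> \<open>Vectors are functions on all naturals. At coordinate 0 the action gives 0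
        because of \<open>sgn 0\<close>, while the reflection leaves \<open>v 0\<close>
        alone.\<close>
      have "v 0 = 0" using that by (simp add: Rvecs_def)
      then show "act n neg_one v k = reflection n (basis_vec 1) v k"
        unfolding reflection_basis_vec_1[OF n] act_involution[OF neg_one_in_WB[OF n] neg_one_neg_one that]
        by (auto simp: neg_one_def sgn_if)
    qed
    then show ?thesis using 1 neg_one_in_WB[OF n]
      by (auto simp: fundamental_reflections_def simple_roots_def)
  next
    case 2
    define i where "i = nat k"
    have i: "1 \<le> i" "i < n" "k = int i" using 2 by (auto simp: i_def)
    let ?r = "\<lambda>k. basis_vec (int i + 1) k - basis_vec (int i) k :: real"
    have "act n (adj_swap k) v = reflection n ?r v" if "v \<in> Rvecs n" for v
    proof
      fix p
      have "v 0 = 0" using that by (simp add: Rvecs_def)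
      then show "act n (adj_swap k) v p = reflection n ?r v p"
        unfolding reflection_basis_vec_diff[OF i(1,2)]
          act_involution[OF adj_swap_in_WB[OF 2(2,3)] adj_swap_adj_swap[OF 2(2)] that]
        using i by (auto simp: adj_swap_def sgn_if nat_add_distrib)
    qed
    moreover have "?r \<in> simple_roots n" using i by (auto simp: simple_roots_def)
    ultimately show ?thesis using 2 adj_swap_in_WB[OF 2(2,3)]
      by (auto simp: fundamental_reflections_def)
  qed
qed

section \<open>Words in the fundamental reflections\<close>

lemma inversions_id: "inversions S id = {}"
  by (auto simp: inversions_def root_pairs_def)

lemma product_append: "product (us @ vs) = product us \<circ> product vs"
  by (induction us) (auto simp: product_def)

lemma product_Nil: "product [] = id"
  by (simp add: product_def fun_eq_iff)

lemma product_Cons: "product (u # vs) = u \<circ> product vs"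
  by (simp add: product_def)

lemma product_in_WB: "set ws \<subseteq> WB n \<Longrightarrow> product ws \<in> WB n"
  by (induction ws) (auto simp: product_def id_in_WB intro!: WB_comp)

text \<open>Each further letter raises the number of inversions by at most one. The induction peels
  letters off the right end, since the generator lemmas describe multiplication on the
  right.\<close>

lemma inversions_product_le:
  assumes n: "1 \<le> n" and "set ws \<subseteq> fundamental_reflections n"
  shows "card (inversions (signed_points n) (product ws)) \<le> length ws"
  using assms(2)
proof (induction ws rule: rev_induct)
  case Nil
  show ?case using inversions_id by (simp add: product_Nil id_def)
next
  case (snoc s ws)
  have "product ws \<in> WB n"
    using snoc.prems by (intro product_in_WB) (auto simp: fundamental_reflections_def)
  moreover have "product (ws @ [s]) = product ws \<circ> s"
    by (simp add: product_append) (simp add: product_def)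
  moreover have "s = neg_one \<or> (\<exists>k. s = adj_swap k \<and> 1 \<le> k \<and> k < int n)"
    using snoc.prems fundamental_reflections_eq[OF n] by auto
  ultimately have "int (card (inversions (signed_points n) (product (ws @ [s])))) \<le>
      int (card (inversions (signed_points n) (product ws))) + 1"
    using card_inversions_neg_one[of "product ws" n] card_inversions_adj_swap[of "product ws" n] n by auto
  then show ?case using snoc by simp
qed

text \<open>An element other than the identity has a descent, and multiplying by the corresponding
  generator removes exactly one inversion. Because the generator is its own inverse, appending it to
  a word for the smaller element gives a word for \<open>w\<close>.\<close>

lemma ex_reduced_word:
  assumes n: "1 \<le> n" and "w \<in> WB n"
  shows "\<exists>ws. length ws = card (inversions (signed_points n) w) \<and>
    set ws \<subseteq> fundamental_reflections n \<and> product ws = w"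
  using assms(2)
proof (induction "card (inversions (signed_points n) w)" arbitrary: w rule: less_induct)
  case less
  show ?case
  proof (cases "w = id")
    case True
    then show ?thesis by (auto simp: inversions_id product_def)
  next
    case False
    have nz: "w 1 \<noteq> 0" using WB_inj[OF less.prems, of 1 0] less.prems by simp
    have ne: "w k \<noteq> w (k + 1)" for k using WB_inj[OF less.prems] by simp
    have "\<exists>s \<in> fundamental_reflections n. s \<circ> s = id \<and>
      int (card (inversions (signed_points n) (w \<circ> s))) = int (card (inversions (signed_points n) w)) - 1"
    proof (cases "w 1 < 0")
      case True
      then show ?thesis using card_inversions_neg_one[OF less.prems n]
        by (intro bexI[of _ neg_one]) (auto simp: fundamental_reflections_eq[OF n])
    next
      case no: False
      then obtain k where k: "1 \<le> k" "k < int n" "w (k + 1) < w k"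
        using WB_eq_id_if_no_descent[OF less.prems] False nz ne by (metis linorder_neqE)
      then show ?thesis using card_inversions_adj_swap[OF less.prems k(1,2)]
        by (intro bexI[of _ "adj_swap k"]) (auto simp: fundamental_reflections_eq[OF n])
    qed
    then obtain s where s: "s \<in> fundamental_reflections n" "s \<circ> s = id"
      and c: "Suc (card (inversions (signed_points n) (w \<circ> s))) = card (inversions (signed_points n) w)"
      by fastforce
    have "w \<circ> s \<in> WB n" using s less.prems by (auto simp: fundamental_reflections_def intro: WB_comp)
    then obtain ws where ws: "length ws = card (inversions (signed_points n) (w \<circ> s))"
      "set ws \<subseteq> fundamental_reflections n" "product ws = w \<circ> s"
      using less.hyps[of "w \<circ> s"] c by auto
    have "product (ws @ [s]) = w"
      using ws(3) s(2) by (simp add: product_append) (simp add: product_def comp_assoc)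
    then show ?thesis using ws c s by (intro exI[of _ "ws @ [s]"]) auto
  qed
qed

lemma len_eq_card_inversions:
  assumes "1 \<le> n" "w \<in> WB n"
  shows "len n w = card (inversions (signed_points n) w)"
  unfolding len_def
  by (rule Least_equality) (use ex_reduced_word[OF assms] inversions_product_le[OF assms(1)] in auto)

subsection \<open>Disjoint signed cycles of an involution\<close>

text \<open>Each transposition of an involution is counted at the larger of its two absolute values.\<close>

definition swaps :: "(int \<Rightarrow> int) \<Rightarrow> int set" where
  "swaps w = {j. \<bar>w j\<bar> < j}"

definition negs :: "(int \<Rightarrow> int) \<Rightarrow> int set" where
  "negs w = {j. 0 < j \<and> w j = - j}"

lemma finite_swaps: "w \<in> WB n \<Longrightarrow> finite (swaps w)"
  by (rule finite_subset[of _ "signed_points n"]) (auto simp: swaps_def, metis WB_outside abs_ge_self not_le)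

lemma finite_negs: "w \<in> WB n \<Longrightarrow> finite (negs w)"
  by (rule finite_subset[of _ "signed_points n"]) (auto simp: negs_def, metis WB_outside equal_neg_zero less_irrefl)

lemma WB_in_moved: "w \<in> WB n \<Longrightarrow> i \<in> moved w \<Longrightarrow> w i \<in> moved w"
  by (simp add: moved_def WB_inj)

lemma moved_subset: "w \<in> WB n \<Longrightarrow> moved w \<subseteq> signed_points n"
  using WB_outside by (auto simp: moved_def)

lemma moved_uminus: "w \<in> WB n \<Longrightarrow> - i \<in> moved w \<longleftrightarrow> i \<in> moved w"
  by (auto simp: moved_def WB_odd)

text \<open>Each signed permutation preserves its own moved set. Hence a point moved by
  \<open>c\<close> is fixed by \<open>d\<close>, and the image under \<open>d\<close> of any other
  point is again fixed by \<open>c\<close>.\<close>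

lemma disjoint_comp_apply:
  assumes "d \<in> WB n" "moved c \<inter> moved d = {}"
  shows "c (d i) = (if i \<in> moved c then c i else d i)"
  using assms WB_in_moved[OF assms(1), of i] by (fastforce simp: moved_def)

lemma moved_disjoint_comp:
  assumes "d \<in> WB n" "moved c \<inter> moved d = {}"
  shows "moved (c \<circ> d) = moved c \<union> moved d"
  using disjoint_comp_apply[OF assms] by (auto simp: moved_def)

text \<open>A signed cycle may a priori have any length. Here the factors of an involution are seen
  to be involutions: the composite acts as \<open>c\<close> on the moved set of \<open>c\<close>,
  which \<open>c\<close> preserves, and likewise for \<open>d\<close>.\<close>

lemma disjoint_comp_involution:
  assumes c: "c \<in> WB n" and d: "d \<in> WB n" and dis: "moved c \<inter> moved d = {}"
    and inv: "\<And>i. c (d (c (d i))) = i"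
  shows "c (c i) = i" "d (d i) = i"
proof -
  note app = disjoint_comp_apply[OF d dis]
  show "c (c i) = i"
  proof (cases "i \<in> moved c")
    case True
    then show ?thesis using inv[of i] WB_in_moved[OF c, of i] by (simp add: app)
  qed (simp add: moved_def)
  show "d (d i) = i"
  proof (cases "i \<in> moved d")
    case True
    then have "i \<notin> moved c" "d i \<notin> moved c" using WB_in_moved[OF d, of i] dis by auto
    then show ?thesis using inv[of i] by (simp add: app)
  qed (simp add: moved_def)
qed

lemma card_swaps_disjoint_comp:
  assumes c: "c \<in> WB n" and d: "d \<in> WB n" and dis: "moved c \<inter> moved d = {}"
  shows "card (swaps (c \<circ> d)) = card (swaps c) + card (swaps d)"
proof -
  have sub: "swaps c \<subseteq> moved c" "swaps d \<subseteq> moved d" by (auto simp: swaps_def moved_def)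
  have "swaps (c \<circ> d) = swaps c \<union> swaps d"
    using dis unfolding swaps_def comp_apply disjoint_comp_apply[OF d dis] by (auto simp: moved_def)
  then show ?thesis using sub dis finite_swaps[OF c] finite_swaps[OF d]
    by (subst card_Un_disjoint[symmetric]) auto
qed

lemma card_negs_disjoint_comp:
  assumes c: "c \<in> WB n" and d: "d \<in> WB n" and dis: "moved c \<inter> moved d = {}"
  shows "card (negs (c \<circ> d)) = card (negs c) + card (negs d)"
proof -
  have sub: "negs c \<subseteq> moved c" "negs d \<subseteq> moved d" by (auto simp: negs_def moved_def)
  have "negs (c \<circ> d) = negs c \<union> negs d"
    using dis unfolding negs_def comp_apply disjoint_comp_apply[OF d dis] by (auto simp: moved_def)
  then show ?thesis using sub dis finite_negs[OF c] finite_negs[OF d]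
    by (subst card_Un_disjoint[symmetric]) auto
qed

text \<open>The orbit of \<open>i\<close> under an involution is \<open>{i, c i}\<close>, so a
  single orbit up to sign is \<open>{i, - i, c i, - c i}\<close>. The cases are distinguished by
  whether this set has two or four elements.\<close>

lemma involutive_signed_cycle_cases:
  assumes c: "signed_cycle n c" and inv: "\<And>i. c (c i) = i"
  obtains "moved c = {}"
    | i where "1 \<le> i" "i \<le> int n" "c i = - i" "moved c = {i, - i}"
    | i where "1 \<le> i" "i \<le> int n" "\<bar>c i\<bar> \<noteq> i" "moved c = {i, - i, c i, - c i}"
proof (cases "moved c = {}")
  case False
  have w: "c \<in> WB n" using c by (simp add: signed_cycle_def)
  obtain j where "j \<in> moved c" using False by blast
  then have "\<bar>j\<bar> \<in> moved c" "j \<noteq> 0"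
    using moved_uminus[OF w] moved_subset[OF w] by (auto simp: abs_if signed_points_def)
  then obtain i where i: "i \<in> moved c" "0 < i" by (metis zero_less_abs_iff)
  have i_le: "1 \<le> i" "i \<le> int n" using i moved_subset[OF w] by (auto simp: signed_points_def)
  have orbit: "(c ^^ k) i \<in> {i, c i}" for k
    by (induction k) (auto simp: inv)
  have "p \<in> {i, - i, c i, - c i}" if p: "p \<in> moved c" for p
  proof -
    obtain k where "\<bar>(c ^^ k) i\<bar> = \<bar>p\<bar>" using c i p by (auto simp: signed_cycle_def)
    then show ?thesis using orbit[of k] by (auto simp: abs_if split: if_splits)
  qed
  moreover have "{i, - i, c i, - c i} \<subseteq> moved c"
    using i WB_in_moved[OF w i(1)] by (simp add: moved_uminus[OF w])
  ultimately have m: "moved c = {i, - i, c i, - c i}" by blast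
  show ?thesis
  proof (cases "\<bar>c i\<bar> = i")
    case True
    then have "c i = - i" using i by (auto simp: moved_def)
    then show ?thesis using that(2)[of i] i_le m by auto
  qed (use that(3)[of i] i_le m in auto)
qed (use that in blast)

text \<open>Identity factors contribute 0 to both counts, so it does not matter whether positive
  1-cycles are listed or left out.\<close>

lemma card_swaps_negs_signed_cycle:
  assumes c: "signed_cycle n c" and inv: "\<And>i. c (c i) = i"
  shows "card (swaps c) = (if transposition_cycle n c then 1 else 0)"
    and "card (negs c) = (if negative_1_cycle n c then 1 else 0)"
proof -
  have w: "c \<in> WB n" using c by (simp add: signed_cycle_def)
  have sub: "swaps c \<subseteq> moved c" "negs c \<subseteq> moved c"
    by (auto simp: swaps_def negs_def moved_def)
  have "card (swaps c) = (if transposition_cycle n c then 1 else 0) \<and>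
    card (negs c) = (if negative_1_cycle n c then 1 else 0)"
    using c inv
  proof (cases rule: involutive_signed_cycle_cases)
    case 1
    then show ?thesis using sub by (auto simp: transposition_cycle_def negative_1_cycle_def)
  next
    case (2 i)
    have c_i: "c (- i) = i" using WB_odd[OF w, of i] 2 by simp
    have "swaps c = {}" using sub(1) 2 c_i by (auto simp: swaps_def)
    moreover have "negs c = {i}" using sub(2) 2 c_i by (auto simp: negs_def)
    moreover have "negative_1_cycle n c" using 2 w by (auto simp: negative_1_cycle_def)
    moreover have "\<not> transposition_cycle n c"
    proof
      assume "transposition_cycle n c"
      then obtain a b where "1 \<le> a" "1 \<le> b" "a \<noteq> b" "moved c = {a, b, - a, - b}"
        by (auto simp: transposition_cycle_def)
      then have "a \<in> {i, - i}" "b \<in> {i, - i}" using 2(4) by auto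
      with \<open>1 \<le> a\<close> \<open>1 \<le> b\<close> \<open>a \<noteq> b\<close> 2(1) show False by auto
    qed
    ultimately show ?thesis by simp
  next
    case (3 i)
    let ?j = "\<bar>c i\<bar>"
    have odd: "c (- i) = - c i" "c (- c i) = - i" "c (c i) = i"
      using WB_odd[OF w, of i] WB_odd[OF w, of "c i"] inv by auto
    have j: "1 \<le> ?j" "?j \<le> int n" using WB_in[OF w, of i] 3 by (auto simp: signed_points_def)
    have c_j: "\<bar>c ?j\<bar> = i" using odd 3 by (auto simp: abs_if)
    \<comment> \<open>Of the two absolute values exchanged by \<open>c\<close>, only the larger has
      an image of smaller absolute value.\<close>
    have "swaps c = {max i ?j}" using sub(1) 3 c_j odd j unfolding swaps_def by (auto simp: max_def abs_if split: if_splits)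
    moreover have "negs c = {}" using sub(2) 3 odd by (auto simp: negs_def)
    moreover have "transposition_cycle n c"
      unfolding transposition_cycle_def using w 3 j odd
      by (intro conjI bexI[of _ i] bexI[of _ ?j]) (auto simp: abs_if split: if_splits)
    moreover have "\<not> negative_1_cycle n c"
    proof
      assume "negative_1_cycle n c"
      then obtain a where "moved c = {a, - a}" by (auto simp: negative_1_cycle_def)
      then have "i \<in> {a, - a}" "c i \<in> {a, - a}" using 3(4) by auto
      then show False using 3(1,3) by auto
    qed
    ultimately show ?thesis by simp
  qed
  then show "card (swaps c) = (if transposition_cycle n c then 1 else 0)"
    "card (negs c) = (if negative_1_cycle n c then 1 else 0)" by auto
qed

text \<open>This turns pairwise disjointness into disjointness of the first factor from the product
  of all the others.\<close>

lemma moved_product: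
  assumes "\<forall>c \<in> set cs. c \<in> WB n" "sorted_wrt (\<lambda>c d. moved c \<inter> moved d = {}) cs"
  shows "moved (product cs) = (\<Union>c\<in>set cs. moved c)"
  using assms
proof (induction cs)
  case Nil
  show ?case unfolding product_Nil by (simp add: moved_def)
next
  case (Cons c cs)
  have "product cs \<in> WB n" using Cons.prems by (intro product_in_WB) auto
  moreover have "moved c \<inter> moved (product cs) = {}" using Cons by auto
  ultimately show ?case using Cons moved_disjoint_comp[of "product cs" n c]
    by (simp add: product_Cons comp_def)
qed

text \<open>The right-hand sides thus depend only on the product, so every disjoint expression of an
  involution has the same counts.\<close>

lemma card_swaps_negs_product:
  assumes "\<forall>c \<in> set cs. signed_cycle n c" "sorted_wrt (\<lambda>c d. moved c \<inter> moved d = {}) cs"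
    and "\<And>i. product cs (product cs i) = i"
  shows "card (swaps (product cs)) = length (filter (transposition_cycle n) cs) \<and>
    card (negs (product cs)) = length (filter (negative_1_cycle n) cs)"
  using assms
proof (induction cs)
  case Nil
  have "swaps id = {}" "negs id = {}" by (auto simp: swaps_def negs_def)
  then show ?case by (simp add: product_Nil id_def)
next
  case (Cons c cs)
  have WB: "\<forall>c \<in> set cs. c \<in> WB n" using Cons.prems by (simp add: signed_cycle_def)
  have c: "signed_cycle n c" "c \<in> WB n" using Cons.prems by (simp_all add: signed_cycle_def)
  have d: "product cs \<in> WB n" using WB by (intro product_in_WB) auto
  have dis: "moved c \<inter> moved (product cs) = {}" using Cons.prems moved_product[OF WB] by auto
  have inv: "c (product cs (c (product cs i))) = i" for i
    using Cons.prems(3)[of i] by (simp add: product_Cons)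
  note invs = disjoint_comp_involution[OF c(2) d dis inv]
  show ?case
    unfolding product_Cons card_swaps_disjoint_comp[OF c(2) d dis] card_negs_disjoint_comp[OF c(2) d dis]
    using Cons.IH[OF _ _ invs(2)] Cons.prems card_swaps_negs_signed_cycle[OF c(1) invs(1)] by simp
qed

text \<open>Split off one orbit up to sign: \<open>c\<close> is \<open>x\<close> on that orbit and
  \<open>y\<close> is \<open>x\<close> off it. Fewer points are moved by \<open>y\<close>, so
  induction on that number applies.\<close>

lemma ex_disjoint_cycle_expression:
  assumes "x \<in> WB n" "\<And>i. x (x i) = i"
  shows "\<exists>cs. disjoint_cycle_expression n x cs"
  using assms
proof (induction "card (moved x)" arbitrary: x rule: less_induct)
  case less
  have odd: "x (- i) = - x i" for i using WB_odd[OF less.prems(1)] .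
  show ?case
  proof (cases "moved x = {}")
    case True
    then have "x = id" by (auto simp: moved_def)
    then show ?thesis by (intro exI[of _ "[]"]) (simp add: disjoint_cycle_expression_def product_def)
  next
    case False
    then obtain i where i: "i \<in> moved x" by blast
    let ?O = "{i, - i, x i, - x i}"
    define c where "c p = (if p \<in> ?O then x p else p)" for p
    define y where "y p = (if p \<in> ?O then p else x p)" for p
    have O: "- p \<in> ?O \<longleftrightarrow> p \<in> ?O" "x p \<in> ?O \<longleftrightarrow> p \<in> ?O" for p
      using odd[of i] odd[of "x i"] odd[of p] less.prems(2)[of i] less.prems(2)[of p]
      by (auto simp: minus_equation_iff)
    have c: "c \<in> WB n"
      by (rule involution_in_WB) (auto simp: c_def O odd less.prems(2) WB_outside[OF less.prems(1)] simp del: insert_iff)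
    have y_inv: "y (y p) = p" for p by (simp add: y_def O less.prems(2) del: insert_iff)
    have y: "y \<in> WB n"
      by (rule involution_in_WB[OF _ _ y_inv]) (auto simp: y_def O odd WB_outside[OF less.prems(1)] simp del: insert_iff)
    have mc: "moved c = ?O" and my: "moved y = moved x - ?O"
      using i odd less.prems(2) by (auto simp: moved_def c_def y_def)
    have "card (moved y) < card (moved x)"
      unfolding my using i finite_subset[OF moved_subset[OF less.prems(1)]]
      by (intro psubset_card_mono) auto
    from less.hyps[OF this y y_inv] obtain cs where cs: "disjoint_cycle_expression n y cs" by blast
    then have "\<forall>c \<in> set cs. c \<in> WB n" "sorted_wrt (\<lambda>c d. moved c \<inter> moved d = {}) cs" "product cs = y"
      by (auto simp: disjoint_cycle_expression_def signed_cycle_def)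
    then have "moved y = (\<Union>d\<in>set cs. moved d)" using moved_product by metis
    then have dis: "\<forall>d\<in>set cs. moved c \<inter> moved d = {}" using mc my by auto
    have dis': "moved c \<inter> moved y = {}" using mc my by auto
    have "c \<circ> y = x"
      using disjoint_comp_apply[OF y dis'] by (auto simp: fun_eq_iff mc c_def y_def)
    moreover have "signed_cycle n c"
      unfolding signed_cycle_def mc
    proof (intro conjI ballI)
      fix p q assume pq: "p \<in> ?O" "q \<in> ?O"
      have "c p = x p" using pq by (simp add: c_def del: insert_iff)
      then have "\<bar>p\<bar> = \<bar>q\<bar> \<or> \<bar>c p\<bar> = \<bar>q\<bar>"
        using pq odd less.prems(2) by (auto simp: abs_if)
      \<comment> \<open>The exponents 0 and 1 suffice.\<close>
      then show "\<exists>k. \<bar>(c ^^ k) p\<bar> = \<bar>q\<bar>"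
        using funpow_0[of c p] funpow.simps(2)[of 0 c] by (metis comp_apply funpow_0 id_apply)
    qed (rule c)
    ultimately show ?thesis using cs dis
      by (intro exI[of _ "c # cs"]) (auto simp: disjoint_cycle_expression_def product_Cons)
  qed
qed

subsection \<open>Counting involutions by the image of the largest point\<close>

text \<open>Bijectivity follows from the involution property. \<open>S\<close> need not be an
  interval of absolute values, which is what deleting an orbit calls for.\<close>

definition odd_involutions :: "int set \<Rightarrow> (int \<Rightarrow> int) set" where
  "odd_involutions S =
     {w. (\<forall>i. i \<notin> S \<longrightarrow> w i = i) \<and> (\<forall>i. w (- i) = - w i) \<and> (\<forall>i. w (w i) = i)}"

definition involution_count :: "int set \<Rightarrow> int \<Rightarrow> int \<Rightarrow> int \<Rightarrow> nat" where
  "involution_count S m e l =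
     card {w \<in> odd_involutions S. int (card (swaps w)) = m \<and> int (card (negs w)) = e \<and>
       int (card (inversions S w)) = l}"

lemma odd_involutions_signed_points:
  "odd_involutions (signed_points n) = {x \<in> WB n. x \<circ> x = id}"
  by (auto simp: odd_involutions_def WB_odd WB_outside fun_eq_iff intro: involution_in_WB)

text \<open>The existential over expressions can be traded for cardinalities: all expressions of an
  involution give the same counts, and at least one exists.\<close>

lemma beta_eq_involution_count:
  assumes "1 \<le> n"
  shows "\<beta> n m e l = involution_count (signed_points n) m e l"
proof -
  have "(\<exists>cs. disjoint_cycle_expression n x cs \<and>
      int (length (filter (transposition_cycle n) cs)) = m \<and>
      int (length (filter (negative_1_cycle n) cs)) = e) \<longleftrightarrow>
      int (card (swaps x)) = m \<and> int (card (negs x)) = e"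
    if x: "x \<in> WB n" "x \<circ> x = id" for x
  proof -
    have inv: "x (x i) = i" for i using x(2) by (simp add: fun_eq_iff)
    have "card (swaps x) = length (filter (transposition_cycle n) cs) \<and>
      card (negs x) = length (filter (negative_1_cycle n) cs)" if "disjoint_cycle_expression n x cs" for cs
      using that card_swaps_negs_product[of cs n] inv by (auto simp: disjoint_cycle_expression_def)
    then show ?thesis using ex_disjoint_cycle_expression[OF x(1) inv] by fastforce
  qed
  then have "{x \<in> WB n. x \<circ> x = id \<and> int (len n x) = l \<and>
       (\<exists>cs. disjoint_cycle_expression n x cs \<and>
          int (length (filter (transposition_cycle n) cs)) = m \<and>
          int (length (filter (negative_1_cycle n) cs)) = e)} =
     {w \<in> odd_involutions (signed_points n). int (card (swaps w)) = m \<and> int (card (negs w)) = e \<and>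
       int (card (inversions (signed_points n) w)) = l}"
    using len_eq_card_inversions[OF assms] unfolding odd_involutions_signed_points by auto
  then show ?thesis by (simp add: \<beta>_def involution_count_def)
qed

lemma odd_involutionsD:
  assumes "w \<in> odd_involutions S"
  shows "i \<notin> S \<Longrightarrow> w i = i" "w (- i) = - w i" "w (w i) = i"
  using assms by (auto simp: odd_involutions_def)

lemma odd_involutions_inj: "w \<in> odd_involutions S \<Longrightarrow> w i = w j \<longleftrightarrow> i = j"
  by (metis odd_involutionsD(3))

lemma odd_involutions_in: "w \<in> odd_involutions S \<Longrightarrow> w i \<in> S \<longleftrightarrow> i \<in> S"
  by (metis odd_involutionsD(1,3))

lemma finite_odd_involutions: "finite (odd_involutions (signed_points n))"
proof (rule finite_subset)
  show "odd_involutions (signed_points n) \<subseteq> {w. w permutes signed_points n}"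
    unfolding odd_involutions_signed_points by (auto simp: WB_def)
qed (simp add: finite_permutations)

text \<open>An increasing odd map preserves order, signs, comparisons of absolute values and the
  sign of \<open>i + j\<close>, and nothing else enters the statistics. The bijection
  \<open>F\<close> transports an involution along it and is the identity off its range.\<close>

lemma involution_count_relabel:
  fixes \<phi> :: "int \<Rightarrow> int"
  assumes mono: "strict_mono \<phi>" and odd: "\<And>i. \<phi> (- i) = - \<phi> i"
  shows "involution_count (\<phi> ` S) m e l = involution_count S m e l"
proof -
  define \<psi> where "\<psi> = inv \<phi>"
  have inj: "inj \<phi>" using mono by (rule strict_mono_imp_inj_on)
  have \<psi>: "\<psi> (\<phi> i) = i" for i by (simp add: \<psi>_def inj)
  have eq_iff: "\<phi> i = \<phi> j \<longleftrightarrow> i = j" for i j using inj by (simp add: inj_eq)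
  note less_iff = strict_mono_less[OF mono] and le_iff = strict_mono_less_eq[OF mono]
  have zero: "\<phi> 0 = 0" using odd[of 0] by simp
  have pos: "0 < \<phi> i \<longleftrightarrow> 0 < i" and neg: "\<phi> i < 0 \<longleftrightarrow> i < 0" for i
    using less_iff[of 0 i] less_iff[of i 0] by (simp_all add: zero)
  have abs: "\<bar>\<phi> i\<bar> = \<phi> \<bar>i\<bar>" for i
    using pos[of i] neg[of i] by (auto simp: abs_if odd)
  have sum: "0 \<le> \<phi> i + \<phi> j \<longleftrightarrow> 0 \<le> i + j" for i j
    using le_iff[of "- i" j] by (auto simp: odd)
  have mem: "\<phi> i \<in> \<phi> ` S \<longleftrightarrow> i \<in> S" for i using eq_iff by auto
  define F where "F y i = (if i \<in> range \<phi> then \<phi> (y (\<psi> i)) else i)" for y :: "int \<Rightarrow> int" and i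
  define G where "G x i = \<psi> (x (\<phi> i))" for x :: "int \<Rightarrow> int" and i
  have F_\<phi>: "F y (\<phi> i) = \<phi> (y i)" for y i by (simp add: F_def \<psi>)
  have F_other: "i \<notin> range \<phi> \<Longrightarrow> F y i = i" for y i by (simp add: F_def)
  have range_uminus: "- i \<in> range \<phi> \<longleftrightarrow> i \<in> range \<phi>" for i
    by (metis (no_types, lifting) odd minus_minus rangeE rangeI)
  have "bij_betw F (odd_involutions S) (odd_involutions (\<phi> ` S))"
  proof (rule bij_betw_byWitness[where f' = G])
    show "\<forall>y\<in>odd_involutions S. G (F y) = y"
      by (simp add: fun_eq_iff G_def F_\<phi> \<psi>)
    \<comment> \<open>Either \<open>x\<close> keeps the point inside the image of \<open>S\<close>,
      or the point lies outside that image and is fixed.\<close>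
    have into: "x (\<phi> i) \<in> range \<phi>" if "x \<in> odd_involutions (\<phi> ` S)" for x i
      using that odd_involutions_in[OF that, of "\<phi> i"] odd_involutionsD(1)[OF that, of "\<phi> i"]
      by (cases "\<phi> i \<in> \<phi> ` S") auto
    have \<phi>_G: "\<phi> (G x i) = x (\<phi> i)" if "x \<in> odd_involutions (\<phi> ` S)" for x i
      using into[OF that, of i] by (auto simp: G_def \<psi>)
    show "\<forall>x\<in>odd_involutions (\<phi> ` S). F (G x) = x"
    proof (intro ballI ext)
      fix x i assume x: "x \<in> odd_involutions (\<phi> ` S)"
      show "F (G x) i = x i"
      proof (cases "i \<in> range \<phi>")
        case True
        then show ?thesis by (auto simp: F_\<phi> \<phi>_G[OF x])
      next
        case False
        then have "i \<notin> \<phi> ` S" by blast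
        then show ?thesis using False odd_involutionsD(1)[OF x] by (simp add: F_other)
      qed
    qed
    show "F ` odd_involutions S \<subseteq> odd_involutions (\<phi> ` S)"
    proof
      fix x assume "x \<in> F ` odd_involutions S"
      then obtain y where y: "y \<in> odd_involutions S" and x: "x = F y" by blast
      have "F y i = i" if "i \<notin> \<phi> ` S" for i
        using that odd_involutionsD(1)[OF y] by (cases "i \<in> range \<phi>") (auto simp: F_\<phi> F_other mem)
      moreover have "F y (- i) = - F y i" for i
      proof (cases "i \<in> range \<phi>")
        case True
        then obtain k where "i = \<phi> k" by blast
        then show ?thesis using F_\<phi>[of y "- k"] F_\<phi>[of y k] odd_involutionsD(2)[OF y] by (simp add: odd)
      qed (simp add: F_other range_uminus)
      moreover have "F y (F y i) = i" for i
        using odd_involutionsD(3)[OF y] by (cases "i \<in> range \<phi>") (auto simp: F_\<phi> F_other)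
      ultimately show "x \<in> odd_involutions (\<phi> ` S)" by (simp add: x odd_involutions_def)
    qed
    show "G ` odd_involutions (\<phi> ` S) \<subseteq> odd_involutions S"
    proof
      fix y assume "y \<in> G ` odd_involutions (\<phi> ` S)"
      then obtain x where x: "x \<in> odd_involutions (\<phi> ` S)" and y: "y = G x" by blast
      have "\<phi> (G x i) = \<phi> i" if "i \<notin> S" for i
        using that odd_involutionsD(1)[OF x, of "\<phi> i"] by (simp add: \<phi>_G[OF x] mem)
      moreover have "\<phi> (G x (- i)) = \<phi> (- G x i)" for i
        using odd_involutionsD(2)[OF x] by (simp add: \<phi>_G[OF x] odd)
      moreover have "\<phi> (G x (G x i)) = \<phi> i" for i
        using odd_involutionsD(3)[OF x] by (simp add: \<phi>_G[OF x])
      ultimately show "y \<in> odd_involutions S" by (simp add: y odd_involutions_def eq_iff)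
    qed
  qed
  moreover have "card (swaps (F y)) = card (swaps y)" for y
  proof -
    have "swaps (F y) = \<phi> ` swaps y"
    proof (intro set_eqI)
      fix j show "j \<in> swaps (F y) \<longleftrightarrow> j \<in> \<phi> ` swaps y"
        by (cases "j \<in> range \<phi>") (auto simp: swaps_def F_\<phi> F_other abs less_iff eq_iff)
    qed
    then show ?thesis by (simp add: card_image inj_on_subset[OF inj])
  qed
  moreover have "card (negs (F y)) = card (negs y)" for y
  proof -
    have "negs (F y) = \<phi> ` negs y"
    proof (intro set_eqI)
      fix j show "j \<in> negs (F y) \<longleftrightarrow> j \<in> \<phi> ` negs y"
        by (cases "j \<in> range \<phi>") (auto simp: negs_def F_\<phi> F_other pos eq_iff simp flip: odd)
    qed
    then show ?thesis by (simp add: card_image inj_on_subset[OF inj])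
  qed
  moreover have "card (inversions (\<phi> ` S) (F y)) = card (inversions S y)" for y
  proof -
    have "inversions (\<phi> ` S) (F y) = map_prod \<phi> \<phi> ` inversions S y"
      by (force simp: inversions_def root_pairs_def F_\<phi> less_iff sum mem)
    moreover have "inj_on (map_prod \<phi> \<phi>) A" for A
      by (auto simp: inj_on_def eq_iff)
    ultimately show ?thesis by (simp add: card_image)
  qed
  ultimately have "bij_betw F
      {y \<in> odd_involutions S. int (card (swaps y)) = m \<and> int (card (negs y)) = e \<and>
        int (card (inversions S y)) = l}
      {x \<in> odd_involutions (\<phi> ` S). int (card (swaps x)) = m \<and> int (card (negs x)) = e \<and>
        int (card (inversions (\<phi> ` S) x)) = l}"
    by (intro bij_betw_Collect) auto
  then show ?thesis unfolding involution_count_def by (rule bij_betw_same_card[symmetric])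
qed

text \<open>The cases \<open>a = p\<close> and \<open>a = - p\<close> are included: they fix, respectively negate, \<open>p\<close>.\<close>

definition extend :: "int \<Rightarrow> int \<Rightarrow> (int \<Rightarrow> int) \<Rightarrow> int \<Rightarrow> int" where
  "extend p a y i =
     (if i = p then a else if i = - p then - a else if i = a then p else if i = - a then - p else y i)"

text \<open>The condition \<open>x p = a\<close> forces the values on all of
  \<open>{p, - p, a, - a}\<close>; the rest is an arbitrary odd involution of the other points. The
  inverse map makes these points fixed.\<close>

lemma bij_betw_extend:
  assumes "p \<in> S" "a \<in> S" and sym: "\<And>i. i \<in> S \<Longrightarrow> - i \<in> S" and zero: "0 \<notin> S"
  shows "bij_betw (extend p a) (odd_involutions (S - {p, - p, a, - a})) {x \<in> odd_involutions S. x p = a}"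
proof -
  have ne: "p \<noteq> 0" "a \<noteq> 0" using assms by auto
  let ?O = "{p, - p, a, - a}"
  show ?thesis
  proof (rule bij_betw_byWitness[where f' = "\<lambda>x i. if i \<in> ?O then i else x i"])
    show "\<forall>y\<in>odd_involutions (S - ?O). (\<lambda>i. if i \<in> ?O then i else extend p a y i) = y"
      by (auto simp: fun_eq_iff extend_def odd_involutionsD(1))
    show "\<forall>x\<in>{x \<in> odd_involutions S. x p = a}. extend p a (\<lambda>i. if i \<in> ?O then i else x i) = x"
    proof (intro ballI ext)
      fix x i assume "x \<in> {x \<in> odd_involutions S. x p = a}"
      then have x: "x \<in> odd_involutions S" "x p = a" by auto
      have "x (- p) = - a" "x a = p" "x (- a) = - p"
        using odd_involutionsD(2,3)[OF x(1), of p] odd_involutionsD(2)[OF x(1), of a] x(2) by auto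
      then show "extend p a (\<lambda>i. if i \<in> ?O then i else x i) i = x i"
        using x(2) by (simp add: extend_def)
    qed
    show "extend p a ` odd_involutions (S - ?O) \<subseteq> {x \<in> odd_involutions S. x p = a}"
    proof
      fix x assume "x \<in> extend p a ` odd_involutions (S - ?O)"
      then obtain y where y: "y \<in> odd_involutions (S - ?O)" and x: "x = extend p a y" by blast
      have fixed: "y i = i" if "i \<in> ?O" for i using odd_involutionsD(1)[OF y] that by blast
      have O_in: "y i \<in> ?O \<longleftrightarrow> i \<in> ?O" for i
        using fixed odd_involutions_inj[OF y] by metis
      have "extend p a y i = i" if "i \<notin> S" for i
        using that assms odd_involutionsD(1)[OF y, of i] by (auto simp: extend_def)
      moreover have "extend p a y (- i) = - extend p a y i" for i
        using odd_involutionsD(2)[OF y, of i] ne by (auto simp: extend_def)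
      moreover have "extend p a y (extend p a y i) = i" for i
      proof (cases "i \<in> ?O")
        case True
        then show ?thesis using ne by (auto simp: extend_def)
      next
        case False
        then show ?thesis using O_in[of i] odd_involutionsD(3)[OF y, of i] by (auto simp: extend_def)
      qed
      ultimately show "x \<in> {x \<in> odd_involutions S. x p = a}"
        by (simp add: x odd_involutions_def) (simp add: extend_def)
    qed
    show "(\<lambda>x i. if i \<in> ?O then i else x i) ` {x \<in> odd_involutions S. x p = a} \<subseteq> odd_involutions (S - ?O)"
    proof
      fix y assume "y \<in> (\<lambda>x i. if i \<in> ?O then i else x i) ` {x \<in> odd_involutions S. x p = a}"
      then obtain x where x: "x \<in> odd_involutions S" "x p = a" and y: "y = (\<lambda>i. if i \<in> ?O then i else x i)"
        by blast
      have O_x: "x (- p) = - a" "x a = p" "x (- a) = - p"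
        using odd_involutionsD(2,3)[OF x(1), of p] odd_involutionsD(2)[OF x(1), of a] x(2) by auto
      then have "x i \<in> ?O" if "i \<in> ?O" for i using that x(2) by auto
      then have O_in: "x i \<in> ?O \<longleftrightarrow> i \<in> ?O" for i
        using odd_involutionsD(3)[OF x(1)] by metis
      have O_neg: "- i \<in> ?O \<longleftrightarrow> i \<in> ?O" for i by auto
      show "y \<in> odd_involutions (S - ?O)"
        unfolding y odd_involutions_def mem_Collect_eq
        using O_in O_neg odd_involutionsD[OF x(1)] by (simp del: insert_iff)
    qed
  qed
qed

lemma signed_points_uminus: "- i \<in> signed_points n \<longleftrightarrow> i \<in> signed_points n"
  by (auto simp: signed_points_def)

lemma zero_notin_signed_points: "0 \<notin> signed_points n"
  by (auto simp: signed_points_def)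

lemma finite_swaps_negs:
  assumes "w \<in> odd_involutions S" "finite S"
  shows "finite (swaps w)" "finite (negs w)"
proof -
  have "swaps w \<subseteq> S" "negs w \<subseteq> S"
    using odd_involutionsD(1)[OF assms(1)] by (force simp: swaps_def negs_def)+
  then show "finite (swaps w)" "finite (negs w)" using assms(2) finite_subset by auto
qed

text \<open>\<open>y\<close> fixes the whole orbit, and the added cycle is counted at its largest
  absolute value, so \<open>int n\<close> is the only point that can enter either set.\<close>

lemma card_swaps_negs_extend:
  assumes n: "1 \<le> n" and a: "a \<in> signed_points n"
    and y: "y \<in> odd_involutions (signed_points n - {int n, - int n, a, - a})"
  shows "card (swaps (extend (int n) a y)) = card (swaps y) + (if \<bar>a\<bar> < int n then 1 else 0)"
    and "card (negs (extend (int n) a y)) = card (negs y) + (if a = - int n then 1 else 0)"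
proof -
  let ?O = "{int n, - int n, a, - a}"
  have fixed: "y i = i" if "i \<in> ?O" for i using odd_involutionsD(1)[OF y] that by blast
  have fin: "finite (swaps y)" "finite (negs y)" using finite_swaps_negs[OF y] by simp_all
  have n_notin: "int n \<notin> swaps y" "int n \<notin> negs y" using fixed[of "int n"] n by (auto simp: swaps_def negs_def)
  have a': "a \<noteq> 0" "\<bar>a\<bar> \<le> int n" using a by (auto simp: signed_points_def)
  have ya: "y a = a" "y (- a) = - a" "y (int n) = int n" "y (- int n) = - int n" using fixed by auto
  have "swaps (extend (int n) a y) = (if \<bar>a\<bar> < int n then insert (int n) (swaps y) else swaps y)"
    unfolding swaps_def extend_def using ya a' n by auto
  then show "card (swaps (extend (int n) a y)) = card (swaps y) + (if \<bar>a\<bar> < int n then 1 else 0)"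
    using fin n_notin by simp
  have "negs (extend (int n) a y) = (if a = - int n then insert (int n) (negs y) else negs y)"
    unfolding negs_def extend_def using ya a' n by auto
  then show "card (negs (extend (int n) a y)) = card (negs y) + (if a = - int n then 1 else 0)"
    using fin n_notin by simp
qed

text \<open>This is the number g of the overview. For negative \<open>a\<close> the integers from
  \<open>a + 1\<close> to \<open>n\<close> include 0, which is not a signed point, hence the extra
  1.\<close>

definition corank :: "nat \<Rightarrow> int \<Rightarrow> int" where
  "corank n a = (if 0 < a then int n - a else int n - a - 1)"

lemma card_points_greater:
  assumes "a \<in> signed_points n"
  shows "int (card {i \<in> signed_points n. a < i}) = corank n a"
proof (cases "0 < a")
  case True
  then have "{i \<in> signed_points n. a < i} = {a + 1..int n}" by (auto simp: signed_points_def)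
  then show ?thesis using True assms by (simp add: corank_def signed_points_def)
next
  case False
  then have "{i \<in> signed_points n. a < i} = {a + 1..int n} - {0}" "0 \<in> {a + 1..int n}"
    using assms by (auto simp: signed_points_def)
  then show ?thesis using False assms by (simp add: corank_def signed_points_def card_Diff_singleton)
qed

text \<open>Inversions avoiding the orbit are those of \<open>y\<close>. The set \<open>E\<close> of
  the others may vary with \<open>y\<close>, but its size does not: \<open>x\<close> carries the
  points \<open>i\<close> with \<open>a < x i\<close> onto the points above \<open>a\<close>,
  whatever \<open>y\<close> is.\<close>

lemma card_inversions_extend:
  assumes n: "1 \<le> n" and a: "a \<in> signed_points n"
    and y: "y \<in> odd_involutions (signed_points n - {int n, - int n, a, - a})"
  shows "int (card (inversions (signed_points n) (extend (int n) a y))) =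
    int (card (inversions (signed_points n - {int n, - int n, a, - a}) y)) +
    (if a = int n then 0 else if a = - int n then 2 * int n - 1 else 2 * corank n a - 1)"
proof -
  let ?S = "signed_points n" and ?O = "{int n, - int n, a, - a}"
  define x where "x = extend (int n) a y"
  have x: "x \<in> odd_involutions ?S" "x (int n) = a"
    using bij_betw_extend[of "int n" ?S a] y a n
    by (auto simp: x_def bij_betw_def signed_points_uminus zero_notin_signed_points signed_points_def)
  note odd = odd_involutionsD(2)[OF x(1)] and inv = odd_involutionsD(3)[OF x(1)]
  have x_O: "x (- int n) = - a" "x a = int n" "x (- a) = - int n"
    using odd[of "int n"] inv[of "int n"] odd[of a] x(2) by auto
  have eq_n: "x i = int n \<longleftrightarrow> i = a" and eq_mn: "x i = - int n \<longleftrightarrow> i = - a" for i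
    using odd_involutions_inj[OF x(1), of i a] odd_involutions_inj[OF x(1), of i "- a"] x_O by auto
  have bound: "- int n \<le> x i" "x i \<le> int n" if "i \<in> ?S" for i
    using odd_involutions_in[OF x(1), of i] that by (auto simp: signed_points_def)
  have a': "a \<noteq> 0" "- int n \<le> a" "a \<le> int n" using a by (auto simp: signed_points_def)
  define orb where "orb = ?O"
  define E where "E = {(i, j) \<in> inversions ?S x. i \<in> orb \<or> j \<in> orb}"
  have x_y: "x i = y i" if "i \<notin> orb" for i using that by (simp add: x_def extend_def orb_def)
  have "inversions ?S x = inversions (?S - orb) y \<union> E"
    unfolding inversions_def root_pairs_def E_def by (auto simp: x_y)
  moreover have "inversions (?S - orb) y \<inter> E = {}"
    by (auto simp: E_def inversions_def root_pairs_def)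
  moreover have "finite E" by (rule finite_subset[of _ "inversions ?S x"]) (auto simp: E_def)
  ultimately have card: "card (inversions ?S x) = card (inversions (?S - ?O) y) + card E"
    by (simp add: card_Un_disjoint flip: orb_def)
  have E_iff: "(i, j) \<in> E \<longleftrightarrow>
      i \<in> ?S \<and> j \<in> ?S \<and> i < j \<and> 0 \<le> i + j \<and> x j < x i \<and> (i \<in> ?O \<or> j \<in> ?O)" for i j
    by (simp only: E_def inversions_def root_pairs_def orb_def mem_Collect_eq prod.case conj_assoc)
  have E1: "int (card {i \<in> ?S. a < x i}) = corank n a"
  proof -
    have "bij_betw x {i \<in> ?S. a < x i} {i \<in> ?S. a < i}"
      by (rule bij_betw_byWitness[where f' = x]) (auto simp: inv odd_involutions_in[OF x(1)])
    then show ?thesis using card_points_greater[OF a] by (simp add: bij_betw_same_card)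
  qed
  \<comment> \<open>For \<open>(i, int n)\<close> to be an inversion, \<open>a < x i\<close>
    suffices: it excludes \<open>i = int n\<close>, and every other signed point meets the order and
    sum conditions.\<close>
  let ?E1 = "(\<lambda>i. (i, int n)) ` {i \<in> ?S. a < x i}"
  have cE1: "int (card ?E1) = corank n a"
    using E1 by (simp add: card_image inj_on_def)
  consider "a = int n" | "a = - int n" | "\<bar>a\<bar> < int n" using a' by linarith
  then have "int (card E) =
    (if a = int n then 0 else if a = - int n then 2 * int n - 1 else 2 * corank n a - 1)"
  proof cases
    case 1
    have "E = {}"
    proof (rule equals0I, clarify)
      fix i j assume "(i, j) \<in> E"
      then have "i \<in> ?S" "j \<in> ?S" "i < j" "0 \<le> i + j" "x j < x i" "i \<in> ?O \<or> j \<in> ?O"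
        unfolding E_iff by blast+
      then show False using 1 x_O x(2) bound[of i] bound[of j] by (auto simp: signed_points_def)
    qed
    then show ?thesis using 1 by simp
  next
    case 2
    have "E = ?E1"
    proof (intro set_eqI iffI; clarify?)
      fix i j assume "(i, j) \<in> E"
      then have "i \<in> ?S" "j \<in> ?S" "i < j" "0 \<le> i + j" "x j < x i" "i \<in> ?O \<or> j \<in> ?O"
        unfolding E_iff by blast+
      then show "(i, j) \<in> ?E1" using 2 x(2) by (auto simp: signed_points_def)
    next
      fix i assume "i \<in> ?S" "a < x i"
      moreover from this have "i \<noteq> int n" using x(2) by auto
      ultimately show "(i, int n) \<in> E" using n x(2)
        by (auto simp: E_iff signed_points_def)
    qed
    then show ?thesis using 2 n cE1 by (simp add: corank_def)
  next
    case 3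
    \<comment> \<open>For \<open>a < 0\<close>, the pairs \<open>(a, j)\<close> with \<open>j < - a\<close> are represented by \<open>(- j, - a)\<close>.\<close>
    define J where "J = {j. max (a + 1) (- a) \<le> j \<and> j < int n}"
    define I where "I = {i. a < i \<and> i < - a \<and> i \<noteq> 0}"
    let ?E2 = "Pair a ` J" and ?E3 = "(\<lambda>i. (i, - a)) ` I"
    have "E = ?E1 \<union> (?E2 \<union> ?E3)"
    proof (rule equalityI; (intro Un_least image_subsetI)?; (rule subrelI)?)
      fix i j assume "(i, j) \<in> E"
      then have ij: "i \<in> ?S" "j \<in> ?S" "i < j" "0 \<le> i + j" "x j < x i" "i \<in> ?O \<or> j \<in> ?O"
        unfolding E_iff by blast+
      then have ij': "- int n \<le> i" "i \<le> int n" "i \<noteq> 0" "j \<le> int n" by (auto simp: signed_points_def)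
      show "(i, j) \<in> ?E1 \<union> (?E2 \<union> ?E3)"
      proof (cases "j = int n")
        case True
        then show ?thesis using ij x(2) by auto
      next
        case False
        \<comment> \<open>With \<open>j\<close> below \<open>n\<close>, the sum condition rules out
          \<open>- n\<close> as an entry. \<open>x\<close> takes its maximum \<open>n\<close> at
          \<open>a\<close> and its minimum \<open>- n\<close> at \<open>- a\<close>, so
          \<open>j = a\<close> and \<open>i = - a\<close> cannot give inversions.\<close>
        have "i = a \<or> j = - a"
          using ij ij' False x_O bound[of i] bound[of j] by auto
        moreover have "j \<in> J" if "i = a" using that ij ij' False by (simp add: J_def)
        moreover have "i \<in> I" if "j = - a" "i \<noteq> a" using that ij ij' by (simp add: I_def)
        ultimately show ?thesis by blast
      qed
    next
      fix i assume "i \<in> {i \<in> ?S. a < x i}"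
      then have i: "i \<in> ?S" "a < x i" by auto
      then have "i \<noteq> int n" using x(2) by auto
      then show "(i, int n) \<in> E" using i n x(2)
        by (auto simp: E_iff signed_points_def)
    next
      fix j assume j: "j \<in> J"
      then have "j \<in> ?S" "j \<noteq> a" using a' by (auto simp: J_def signed_points_def)
      then have "x j < int n" using bound[of j] eq_n[of j] by auto
      then show "(a, j) \<in> E" using j \<open>j \<in> ?S\<close> a x_O
        by (auto simp: E_iff J_def)
    next
      fix i assume i: "i \<in> I"
      then have "i \<in> ?S" "i \<noteq> - a" using 3 by (auto simp: I_def signed_points_def)
      then have "- int n < x i" using bound[of i] eq_mn[of i] by auto
      then show "(i, - a) \<in> E" using i \<open>i \<in> ?S\<close> a x_O
        by (auto simp: E_iff I_def signed_points_uminus)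
    qed
    moreover have "?E1 \<inter> (?E2 \<union> ?E3) = {}" using 3 by (auto simp: J_def)
    moreover have "?E2 \<inter> ?E3 = {}" by (auto simp: I_def)
    moreover have fin: "finite I" "finite J"
      by (rule finite_subset[of _ "{- int n..int n}"], use 3 in \<open>auto simp: I_def J_def\<close>)+
    ultimately have "card E = card {i \<in> ?S. a < x i} + (card J + card I)"
      by (simp add: card_Un_disjoint card_image inj_on_def)
    moreover have "int (card J) = int n - max (a + 1) (- a)"
    proof -
      have "J = {max (a + 1) (- a)..<int n}" by (auto simp: J_def)
      then show ?thesis using 3 by auto
    qed
    moreover have "int (card I) = (if 0 < a then 0 else - 2 * a - 2)"
    proof (cases "0 < a")
      case True
      then have "I = {}" by (auto simp: I_def)
      then show ?thesis using True by simp
    next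
      case False
      then have "I = {a + 1..- a - 1} - {0}" "0 \<in> {a + 1..- a - 1}" using a' by (auto simp: I_def)
      then show ?thesis using False a' by (simp add: card_Diff_singleton)
    qed
    \<comment> \<open>The sizes of \<open>J\<close> and \<open>I\<close> add up to
      \<open>corank n a - 1\<close> for either sign of \<open>a\<close>; the missing pair
      \<open>(a, int n)\<close> is already in \<open>?E1\<close>.\<close>
    ultimately show ?thesis using E1 3 a' by (auto simp: corank_def)
  qed
  then show ?thesis using card by (simp add: x_def)
qed

lemma card_involutions_fibre:
  assumes n: "1 \<le> n" and a: "a \<in> signed_points n"
  shows "card {w \<in> odd_involutions (signed_points n). w (int n) = a \<and>
      int (card (swaps w)) = m \<and> int (card (negs w)) = e \<and> int (card (inversions (signed_points n) w)) = l} =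
    involution_count (signed_points n - {int n, - int n, a, - a})
      (if \<bar>a\<bar> < int n then m - 1 else m) (if a = - int n then e - 1 else e)
      (l - (if a = int n then 0 else if a = - int n then 2 * int n - 1 else 2 * corank n a - 1))"
    (is "card ?B = involution_count ?S ?m ?e ?l")
proof -
  have bij: "bij_betw (extend (int n) a) (odd_involutions ?S) {x \<in> odd_involutions (signed_points n). x (int n) = a}"
    using a n by (intro bij_betw_extend)
      (auto simp: signed_points_uminus zero_notin_signed_points signed_points_def)
  let ?A = "{y \<in> odd_involutions ?S. int (card (swaps y)) = ?m \<and> int (card (negs y)) = ?e \<and>
    int (card (inversions ?S y)) = ?l}"
  have stats: "extend (int n) a y \<in> ?B \<longleftrightarrow> y \<in> ?A" if y: "y \<in> odd_involutions ?S" for y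
  proof -
    have "extend (int n) a y \<in> {x \<in> odd_involutions (signed_points n). x (int n) = a}"
      using bij y by (auto simp: bij_betw_def)
    then show ?thesis
      using y card_swaps_negs_extend[OF n a y] card_inversions_extend[OF n a y] by auto
  qed
  have "?B = extend (int n) a ` ?A"
  proof (intro set_eqI iffI)
    fix w assume w: "w \<in> ?B"
    then have "w \<in> extend (int n) a ` odd_involutions ?S" using bij by (auto simp: bij_betw_def)
    then show "w \<in> extend (int n) a ` ?A" using stats w by blast
  qed (use stats in blast)
  moreover have "inj_on (extend (int n) a) ?A"
    using bij by (auto simp: bij_betw_def intro: inj_on_subset)
  ultimately show ?thesis by (simp add: card_image involution_count_def)
qed

lemma involution_count_remove_two:
  assumes "0 < \<bar>a\<bar>" "\<bar>a\<bar> < int n"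
  shows "involution_count (signed_points n - {int n, - int n, a, - a}) m e l =
    involution_count (signed_points (n - 2)) m e l"
proof -
  \<comment> \<open>Points of absolute value at least |a| move one step away from 0, which opens the
    gap at \<open>a\<close> and \<open>- a\<close>.\<close>
  define \<phi> where "\<phi> i = (if \<bar>i\<bar> < \<bar>a\<bar> then i else i + sgn i)" for i
  have "strict_mono \<phi>" by (rule strict_monoI) (auto simp: \<phi>_def sgn_if)
  moreover have "\<phi> (- i) = - \<phi> i" for i by (auto simp: \<phi>_def sgn_if)
  moreover have "\<phi> ` signed_points (n - 2) = signed_points n - {int n, - int n, a, - a}"
  proof (intro equalityI subsetI)
    fix j assume "j \<in> \<phi> ` signed_points (n - 2)"
    then show "j \<in> signed_points n - {int n, - int n, a, - a}"
      using assms by (auto simp: \<phi>_def sgn_if signed_points_def of_nat_diff split: if_splits)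
  next
    fix j assume j: "j \<in> signed_points n - {int n, - int n, a, - a}"
    let ?i = "if \<bar>j\<bar> < \<bar>a\<bar> then j else j - sgn j"
    have "\<phi> ?i = j" using j assms by (auto simp: \<phi>_def sgn_if signed_points_def)
    moreover have "?i \<in> signed_points (n - 2)"
      using j assms by (auto simp: sgn_if signed_points_def of_nat_diff)
    ultimately show "j \<in> \<phi> ` signed_points (n - 2)" by (metis imageI)
  qed
  ultimately show ?thesis using involution_count_relabel[of \<phi> "signed_points (n - 2)"] by metis
qed

text \<open>For \<open>n = 1\<close> the sum is empty, so the truncated \<open>n - 2\<close> is
  harmless and the recursion can start from \<open>n = 0\<close>.\<close>

lemma involution_count_rec:
  assumes n: "1 \<le> n"
  shows "involution_count (signed_points n) m e l =
    involution_count (signed_points (n - 1)) m e l +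
    involution_count (signed_points (n - 1)) m (e - 1) (l + 1 - 2 * int n) +
    (\<Sum>k = 1..2 * n - 2. involution_count (signed_points (n - 2)) (m - 1) e (l + 1 - 2 * int k))"
proof -
  let ?S = "signed_points n"
  let ?P = "\<lambda>w. int (card (swaps w)) = m \<and> int (card (negs w)) = e \<and> int (card (inversions ?S w)) = l"
  let ?B = "\<lambda>a. {w \<in> odd_involutions ?S. w (int n) = a \<and> ?P w}"
  have n_in: "int n \<in> ?S" using n by (auto simp: signed_points_def)
  have split: "?S = insert (int n) (insert (- int n) (signed_points (n - 1)))"
    using n by (auto simp: signed_points_def of_nat_diff)
  have "{w \<in> odd_involutions ?S. ?P w} = (\<Union>a\<in>?S. ?B a)"
    using odd_involutions_in n_in by blast
  then have "involution_count ?S m e l = card (\<Union>a\<in>?S. ?B a)"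
    unfolding involution_count_def by simp
  also have "\<dots> = (\<Sum>a\<in>?S. card (?B a))"
    by (rule card_UN_disjoint) (auto intro: finite_subset[OF _ finite_odd_involutions])
  also have "\<dots> = card (?B (int n)) + (card (?B (- int n)) + (\<Sum>a\<in>signed_points (n - 1). card (?B a)))"
  proof -
    have "int n \<notin> insert (- int n) (signed_points (n - 1))" "- int n \<notin> signed_points (n - 1)"
      using n by (auto simp: signed_points_def)
    then show ?thesis by (subst split) simp
  qed
  also have "card (?B (int n)) = involution_count (signed_points (n - 1)) m e l"
  proof -
    have eq: "?S - {int n, - int n, int n, - int n} = signed_points (n - 1)"
      using n by (auto simp: signed_points_def of_nat_diff)
    then show ?thesis using card_involutions_fibre[OF n n_in, of m e l, unfolded eq] n by simp
  qed
  also have "card (?B (- int n)) = involution_count (signed_points (n - 1)) m (e - 1) (l + 1 - 2 * int n)"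
  proof -
    have mn_in: "- int n \<in> ?S" using n_in by (simp add: signed_points_uminus)
    have eq: "?S - {int n, - int n, - int n, - (- int n)} = signed_points (n - 1)"
      using n by (auto simp: signed_points_def of_nat_diff)
    show ?thesis using card_involutions_fibre[OF n mn_in, of m e l, unfolded eq] n by (simp add: algebra_simps)
  qed
  also have "(\<Sum>a\<in>signed_points (n - 1). card (?B a)) =
    (\<Sum>k = 1..2 * n - 2. involution_count (signed_points (n - 2)) (m - 1) e (l + 1 - 2 * int k))"
  \<comment> \<open>The index is \<open>k = corank n a\<close>. Positive \<open>a\<close> gives
    \<open>k < n\<close> with \<open>a = n - k\<close>; negative \<open>a\<close> gives
    \<open>k\<close> from \<open>n\<close> on, with \<open>a = n - 1 - k\<close>.\<close>
  proof (rule sum.reindex_bij_witness[where j = "\<lambda>a. nat (corank n a)"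
        and i = "\<lambda>k. if k < n then int n - int k else int n - 1 - int k"])
    fix a assume a: "a \<in> signed_points (n - 1)"
    then have a': "a \<in> ?S" "0 < \<bar>a\<bar>" "\<bar>a\<bar> < int n" using split n by (auto simp: signed_points_def of_nat_diff)
    then show "(if nat (corank n a) < n then int n - int (nat (corank n a))
        else int n - 1 - int (nat (corank n a))) = a" "nat (corank n a) \<in> {1..2 * n - 2}"
      by (auto simp: corank_def)
    have "0 \<le> corank n a" using a' by (auto simp: corank_def)
    then show "involution_count (signed_points (n - 2)) (m - 1) e (l + 1 - 2 * int (nat (corank n a))) = card (?B a)"
      using card_involutions_fibre[OF n a'(1), of m e l] involution_count_remove_two[OF a'(2,3)] a'
      by (auto simp: algebra_simps)
  next
    fix k assume "k \<in> {1..2 * n - 2}"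
    then show "nat (corank n (if k < n then int n - int k else int n - 1 - int k)) = k"
      "(if k < n then int n - int k else int n - 1 - int k) \<in> signed_points (n - 1)"
      by (auto simp: corank_def signed_points_def of_nat_diff)
  qed
  finally show ?thesis by simp
qed

section \<open>Bounds on the statistics and vanishing of counts\<close>

lemma swaps_negs_subset:
  assumes "w \<in> odd_involutions (signed_points n)"
  shows "swaps w \<subseteq> {1..int n}" "negs w \<subseteq> {1..int n}"
proof -
  have "j \<in> {1..int n}" if "j \<in> swaps w \<union> negs w" for j
  proof -
    have "w j \<noteq> j" "0 < j" using that by (auto simp: swaps_def negs_def)
    then have "j \<in> signed_points n" using odd_involutionsD(1)[OF assms] by blast
    then show ?thesis using \<open>0 < j\<close> by (simp add: signed_points_def)
  qed
  then show "swaps w \<subseteq> {1..int n}" "negs w \<subseteq> {1..int n}" by blast+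
qed

lemma swaps_negs_disjoint: "swaps w \<inter> negs w = {}"
  by (auto simp: swaps_def negs_def)

text \<open>Each counted point \<open>j\<close> yields its own inversion \<open>(w j, j)\<close>,
  because \<open>w\<close> exchanges the two entries.\<close>

lemma card_swaps_negs_le_inversions:
  assumes w: "w \<in> odd_involutions (signed_points n)"
  shows "card (swaps w) + card (negs w) \<le> card (inversions (signed_points n) w)"
proof -
  have "card (swaps w) + card (negs w) = card (swaps w \<union> negs w)"
    using finite_swaps_negs[OF w] swaps_negs_disjoint by (simp add: card_Un_disjoint)
  also have "\<dots> \<le> card (inversions (signed_points n) w)"
  proof (rule card_inj_on_le)
    show "inj_on (\<lambda>j. (w j, j)) (swaps w \<union> negs w)" by (simp add: inj_on_def)
    show "(\<lambda>j. (w j, j)) ` (swaps w \<union> negs w) \<subseteq> inversions (signed_points n) w"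
    proof (intro image_subsetI)
      fix j assume j: "j \<in> swaps w \<union> negs w"
      then have j_in: "j \<in> signed_points n" using swaps_negs_subset[OF w] by (auto simp: signed_points_def)
      have "w j < j" "0 \<le> w j + j" using j by (auto simp: swaps_def negs_def)
      then show "(w j, j) \<in> inversions (signed_points n) w"
        using j_in by (simp add: inversions_def root_pairs_def odd_involutions_in[OF w] odd_involutionsD(3)[OF w])
    qed
  qed simp
  finally show ?thesis .
qed

lemma abs_swap_partner:
  assumes w: "w \<in> odd_involutions S"
  shows "\<bar>w \<bar>w j\<bar>\<bar> = \<bar>j\<bar>"
  using odd_involutionsD(2,3)[OF w] by (simp add: abs_if)

text \<open>The smaller absolute values of the transpositions form a further set \<open>?T\<close>
  inside \<open>{1..n}\<close>, of the size of \<open>swaps w\<close> and disjoint from both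
  \<open>swaps w\<close> and \<open>negs w\<close>.\<close>

lemma two_card_swaps_negs_le:
  assumes w: "w \<in> odd_involutions (signed_points n)"
  shows "2 * card (swaps w) + card (negs w) \<le> n"
proof -
  let ?T = "(\<lambda>j. \<bar>w j\<bar>) ` swaps w"
  have inj: "inj_on (\<lambda>j. \<bar>w j\<bar>) (swaps w)"
  proof (rule inj_onI)
    fix i j assume "i \<in> swaps w" "j \<in> swaps w" "\<bar>w i\<bar> = \<bar>w j\<bar>"
    moreover from this have "\<bar>i\<bar> = \<bar>j\<bar>" using abs_swap_partner[OF w] by metis
    ultimately show "i = j" by (auto simp: swaps_def)
  qed
  have partner: "k < \<bar>w k\<bar>" if "k \<in> ?T" for k
    using that abs_swap_partner[OF w] by (auto simp: swaps_def)
  have T_sub: "?T \<subseteq> {1..int n}"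
  proof (intro image_subsetI)
    fix j assume j: "j \<in> swaps w"
    then have "j \<in> signed_points n" using swaps_negs_subset[OF w] by (auto simp: signed_points_def)
    then have "w j \<in> signed_points n" using odd_involutions_in[OF w] by simp
    then show "\<bar>w j\<bar> \<in> {1..int n}" by (auto simp: signed_points_def)
  qed
  have dis: "swaps w \<inter> ?T = {}" "negs w \<inter> ?T = {}"
    using partner by (fastforce simp: swaps_def negs_def)+
  have fin: "finite (swaps w)" "finite (negs w)" using finite_swaps_negs[OF w] by simp_all
  have "2 * card (swaps w) + card (negs w) = card (swaps w \<union> negs w) + card ?T"
    using fin swaps_negs_disjoint by (simp add: card_Un_disjoint card_image[OF inj])
  also have "\<dots> = card ((swaps w \<union> negs w) \<union> ?T)"
    using fin dis by (subst card_Un_disjoint) auto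
  also have "\<dots> \<le> card {1..int n}"
    using swaps_negs_subset[OF w] T_sub by (intro card_mono) auto
  finally show ?thesis by simp
qed

lemma involution_count_eq_0:
  assumes "m < 0 \<or> e < 0 \<or> l < m + e \<or> int n < 2 * m + e"
  shows "involution_count (signed_points n) m e l = 0"
proof -
  have "\<not> (int (card (swaps w)) = m \<and> int (card (negs w)) = e \<and>
      int (card (inversions (signed_points n) w)) = l)" if "w \<in> odd_involutions (signed_points n)" for w
    using card_swaps_negs_le_inversions[OF that] two_card_swaps_negs_le[OF that] assms by linarith
  then have "{w \<in> odd_involutions (signed_points n). int (card (swaps w)) = m \<and> int (card (negs w)) = e \<and>
      int (card (inversions (signed_points n) w)) = l} = {}" by blast
  then show ?thesis by (simp only: involution_count_def card.empty)
qed

lemma id_in_odd_involutions: "id \<in> odd_involutions S"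
  by (simp add: odd_involutions_def)

text \<open>A moved positive point outside both sets has a partner of larger absolute value, and
  that absolute value lies in \<open>swaps w\<close>.\<close>

lemma odd_involution_eq_id:
  assumes w: "w \<in> odd_involutions (signed_points n)" and "swaps w = {}" "negs w = {}"
  shows "w = id"
proof -
  have "w j = j" if "1 \<le> j" for j
  proof (rule ccontr)
    assume "w j \<noteq> j"
    moreover have "j \<notin> swaps w" "j \<notin> negs w" using assms(2,3) by auto
    ultimately have "j < \<bar>w j\<bar>" using that by (auto simp: swaps_def negs_def)
    then have "\<bar>w j\<bar> \<in> swaps w" using abs_swap_partner[OF w, of j] that by (simp add: swaps_def)
    then show False using assms(2) by simp
  qed
  moreover have "w \<in> WB n" using w by (simp add: odd_involutions_signed_points)
  ultimately show ?thesis by (intro WB_eqI[OF _ id_in_WB]) auto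
qed

lemma involution_count_0_0:
  "involution_count (signed_points n) 0 0 l = (if l = 0 then 1 else 0)"
proof -
  have "int (card (swaps w)) = 0 \<and> int (card (negs w)) = 0 \<and>
      int (card (inversions (signed_points n) w)) = l \<longleftrightarrow> w = id \<and> l = 0"
    if w: "w \<in> odd_involutions (signed_points n)" for w
  proof -
    have "swaps id = {}" "negs id = {}" by (auto simp: swaps_def negs_def)
    then have "swaps w = {} \<and> negs w = {} \<longleftrightarrow> w = id" using odd_involution_eq_id[OF w] by blast
    then show ?thesis using finite_swaps_negs[OF w] by (auto simp: inversions_id)
  qed
  then have "{w \<in> odd_involutions (signed_points n). int (card (swaps w)) = 0 \<and> int (card (negs w)) = 0 \<and>
       int (card (inversions (signed_points n) w)) = l} = {w \<in> odd_involutions (signed_points n). w = id \<and> l = 0}"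
    by blast
  also have "\<dots> = (if l = 0 then {id} else {})" using id_in_odd_involutions by auto
  finally have "{w \<in> odd_involutions (signed_points n). int (card (swaps w)) = 0 \<and> int (card (negs w)) = 0 \<and>
       int (card (inversions (signed_points n) w)) = l} = (if l = 0 then {id} else {})" .
  then show ?thesis by (simp add: involution_count_def)
qed

subsection \<open>Generating functions\<close>

text \<open>This series is identified with \<open>L\<close> for \<open>n\<close> at least 1; the
  value at \<open>n = 0\<close> serves as the base of the recursion.\<close>

definition involution_fps :: "nat \<Rightarrow> int \<Rightarrow> int \<Rightarrow> rat fps" where
  "involution_fps n m e = Abs_fps (\<lambda>l. of_nat (involution_count (signed_points n) m e (int l)))"

lemma involution_fps_nth:
  "fps_nth (involution_fps n m e) l = of_nat (involution_count (signed_points n) m e (int l))"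
  by (simp add: involution_fps_def)

text \<open>Counts at negative length vanish, so multiplication by a power of \<open>fps_X\<close>
  is a plain shift of the integer index, also below exponent \<open>k\<close>.\<close>

lemma fps_X_power_mult_involution_fps_nth:
  "fps_nth (fps_X ^ k * involution_fps n m e) l =
    of_nat (involution_count (signed_points n) m e (int l - int k))"
proof (cases "l < k")
  case True
  then have "involution_count (signed_points n) m e (int l - int k) = 0"
    by (cases "m < 0 \<or> e < 0") (auto intro: involution_count_eq_0)
  then show ?thesis using True by (simp add: fps_X_power_mult_nth)
qed (simp add: fps_X_power_mult_nth involution_fps_nth of_nat_diff)

lemma L_eq_involution_fps: "1 \<le> n \<Longrightarrow> L n m e = involution_fps n m e"
  by (simp add: L_def involution_fps_def beta_eq_involution_count)

lemma involution_fps_rec: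
  assumes "1 \<le> n"
  shows "involution_fps n m e = involution_fps (n - 1) m e
    + fps_X ^ (2 * n - 1) * involution_fps (n - 1) m (e - 1)
    + (\<Sum>k = 1..2 * n - 2. fps_X ^ (2 * k - 1)) * involution_fps (n - 2) (m - 1) e"
proof (rule fps_ext)
  fix l
  have n_eq: "int l - int (2 * n - 1) = int l + 1 - 2 * int n" using assms by (simp add: of_nat_diff)
  have k_eq: "int l - int (2 * k - 1) = int l + 1 - 2 * int k" if "k \<in> {1..2 * n - 2}" for k
    using that by (simp add: of_nat_diff)
  have "fps_nth ((\<Sum>k = 1..2 * n - 2. fps_X ^ (2 * k - 1)) * involution_fps (n - 2) (m - 1) e) l =
    of_nat (\<Sum>k = 1..2 * n - 2. involution_count (signed_points (n - 2)) (m - 1) e (int l + 1 - 2 * int k))"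
    unfolding sum_distrib_right fps_sum_nth fps_X_power_mult_involution_fps_nth of_nat_sum
    by (intro sum.cong) (simp_all only: k_eq)
  then show "fps_nth (involution_fps n m e) l = fps_nth (involution_fps (n - 1) m e
    + fps_X ^ (2 * n - 1) * involution_fps (n - 1) m (e - 1)
    + (\<Sum>k = 1..2 * n - 2. fps_X ^ (2 * k - 1)) * involution_fps (n - 2) (m - 1) e) l"
    by (simp only: fps_add_nth involution_fps_nth fps_X_power_mult_involution_fps_nth
        involution_count_rec[OF assms, of m e "int l"] n_eq of_nat_add)
qed

lemma involution_fps_eq_0:
  assumes "m < 0 \<or> e < 0 \<or> int n < 2 * m + e"
  shows "involution_fps n m e = 0"
  using assms by (intro fps_ext) (auto simp: involution_fps_nth intro: involution_count_eq_0)

lemma involution_fps_0_0: "involution_fps n 0 0 = 1"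
  by (rule fps_ext) (simp add: involution_fps_nth involution_count_0_0)

text \<open>Multiplying by \<open>fps_X ^ 2 - 1\<close> telescopes the sum. This factor has constant
  term -1, so it is nonzero and can be cancelled.\<close>

lemma sum_odd_powers:
  "(\<Sum>k = 1..N. fps_X ^ (2 * k - 1)) = (fps_X * (fps_X ^ (2 * N) - 1) / (fps_X ^ 2 - 1) :: rat fps)"
proof -
  have eq: "(\<Sum>k = 1..N. fps_X ^ (2 * k - 1)) * (fps_X ^ 2 - 1) = (fps_X * (fps_X ^ (2 * N) - 1) :: rat fps)"
    by (induction N) (simp_all add: algebra_simps power2_eq_square)
  have "fps_nth (fps_X ^ 2 - 1) 0 \<noteq> (0 :: rat)" by simp
  then have "fps_X ^ 2 - 1 \<noteq> (0 :: rat fps)" by (metis fps_zero_nth)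
  then show ?thesis unfolding eq[symmetric] by (rule nonzero_mult_div_cancel_right[symmetric])
qed

theorem theorem1p2:
  shows
    "(\<forall>n\<ge>3. \<forall>m\<ge>0. \<forall>e\<ge>0. \<forall>l::int.
        (l < m + e \<longrightarrow> \<beta> n m e l = 0) \<and>
        (l \<ge> m + e \<longrightarrow>
          \<beta> n m e l = \<beta> (n - 1) m e l + \<beta> (n - 1) m (e - 1) (l + 1 - 2 * int n)
            + (\<Sum>k = 1..2 * n - 2. \<beta> (n - 2) (m - 1) e (l + 1 - 2 * int k)))) \<and>
     (\<forall>n\<ge>1. L n 0 0 = 1) \<and>
     L 1 0 1 = fps_X \<and>
     L 2 1 0 = fps_X + fps_X ^ 3 \<and>
     L 2 0 1 = fps_X + fps_X ^ 3 \<and>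
     L 2 0 2 = fps_X ^ 4 \<and>
     (\<forall>n\<ge>1. \<forall>m e. int n < 2 * m + e \<longrightarrow> L n m e = 0) \<and>
     (\<forall>n\<ge>3. \<forall>m\<ge>0. \<forall>e\<ge>0.
        L n m e = L (n - 1) m e + fps_X ^ (2 * n - 1) * L (n - 1) m (e - 1)
          + fps_X * (fps_X ^ (4 * n - 4) - 1) / (fps_X ^ 2 - 1) * L (n - 2) (m - 1) e)"
proof -
  \<comment> \<open>The listed series for ranks 1 and 2 come from the recursion itself, started at
    rank 0, where only the identity exists.\<close>
  have rec1: "involution_fps 1 m e = involution_fps 0 m e + fps_X * involution_fps 0 m (e - 1)" for m e
    using involution_fps_rec[of 1 m e] by simp
  have rec2: "involution_fps 2 m e = involution_fps 1 m e + fps_X ^ 3 * involution_fps 1 m (e - 1)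
      + (fps_X + fps_X ^ 3) * involution_fps 0 (m - 1) e" for m e
  proof -
    have "{1..2 * 2 - 2} = {1, 2 :: nat}" by auto
    then show ?thesis using involution_fps_rec[of 2 m e] by simp
  qed
  have L101: "involution_fps 1 0 1 = fps_X"
    using rec1[of 0 1] by (simp add: involution_fps_0_0 involution_fps_eq_0)
  have "involution_fps 2 1 0 = fps_X + fps_X ^ 3"
    using rec2[of 1 0] by (simp add: involution_fps_0_0 involution_fps_eq_0)
  moreover have "involution_fps 2 0 1 = fps_X + fps_X ^ 3"
    using rec2[of 0 1] L101 by (simp add: involution_fps_0_0 involution_fps_eq_0)
  moreover have "involution_fps 2 0 2 = fps_X ^ 4"
    using rec2[of 0 2] L101 by (simp add: involution_fps_eq_0 flip: power_Suc2)
  moreover have "\<beta> n m e l = \<beta> (n - 1) m e l + \<beta> (n - 1) m (e - 1) (l + 1 - 2 * int n)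
      + (\<Sum>k = 1..2 * n - 2. \<beta> (n - 2) (m - 1) e (l + 1 - 2 * int k))" if "3 \<le> n" for n m e l
    using that by (simp add: beta_eq_involution_count involution_count_rec)
  moreover have "L n m e = L (n - 1) m e + fps_X ^ (2 * n - 1) * L (n - 1) m (e - 1)
      + fps_X * (fps_X ^ (4 * n - 4) - 1) / (fps_X ^ 2 - 1) * L (n - 2) (m - 1) e" if "3 \<le> n" for n m e
  proof -
    have "2 * (2 * n - 2) = 4 * n - 4" by simp
    then show ?thesis
      using that involution_fps_rec[of n m e] sum_odd_powers[of "2 * n - 2"]
      by (simp add: L_eq_involution_fps)
  qed
  ultimately show ?thesis
    using L101 by (simp add: L_eq_involution_fps involution_fps_0_0 involution_fps_eq_0
        beta_eq_involution_count involution_count_eq_0)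
qed

end
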